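(* Let $p$ be an odd prime and let $\lambda=(\lambda_1,\dots,\lambda_n)$, $\lambda_n\neq 0$, be a ${\bf T}$-regular partition with ${\bf T}$-conjugate $\gamma=(\gamma_1,\dots,\gamma_m)$ of length $m$. For $1\le k\le m$, write $\gamma_k=(n_k-1)(p-1)+b_k$, where $n_k\ge 1$ and $1\le b_k\le p-1$. Then $$\widehat{P}^{r_m}\cdots\widehat{P}^{r_2}\,\widehat{P}^{r_1}\,v(\lambda)=w(\lambda'),$$ where $$r_k=(b_k+1)\,p_{n_k-1}-(n_k-1)-\sum_{j=k+1}^m p^{\,j-k-1}\gamma_j .$$
   Context: ${\bf P}=\mathbb{F}_p[x_1,\dots,x_n]$ is graded with each $x_i$ in degree $1$. $\mathcal{A}_p$ is the algebra of Steenrod $p$th powers (mod $p$ Steenrod algebra without Bocksteins), generated by $P^r$, $r\ge0$, $P^0=1$. It acts on ${\bf P}$ on the left by linear maps: $P^1x_i=x_i^p$, $P^rx_i=0$ for $r>1$, $P^r1=0$ for $r>0$, with Cartan formula $P^r(fg)=\sum_{s+t=r}P^sf\cdot P^tg$. The canonical anti-automorphism $\chi$ of $\mathcal{A}_p$ is determined by $\chi(1)=1$ and $\sum_{i+j=r}P^i\chi(P^j)=0$ for $r\ge1$. Put $\widehat{P}^r=(-1)^r\chi(P^r)$. $p_k=(p^k-1)/(p-1)$ for $k\ge0$. $[x_{i_1}^{s_1},\dots,x_{i_k}^{s_k}]$ denotes the $k\times k$ determinant with $(a,b)$ entry $x_{i_b}^{s_a}$. $w(k)=[x_1,x_2^p,\dots,x_k^{p^{k-1}}]$.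 A partition $\lambda=(\lambda_1,\dots,\lambda_n)$ is column $p$-regular if $0\le\lambda_i-\lambda_{i+1}\le p-1$ for $1\le i\le n$ (with $\lambda_{n+1}=0$). It is ${\bf T}$-regular if it is column $p$-regular and for every $a\ge1$ there is at most one $i$ with $(a-1)(p-1)<\lambda_i<a(p-1)$. Its diagram is the set of boxes $(i,j)$, $1\le i\le n$, $1\le j\le\lambda_i$ (row $i$, column $j$). Divide the diagram into consecutive blocks of $p-1$ columns (the last block may have fewer); $\gamma_j$ is the number of boxes in the $j$th block, and $\gamma=(\gamma_1,\gamma_2,\dots)$ is the ${\bf T}$-conjugate of $\lambda$; its length $m$ is the number of nonempty blocks. The $k$th antidiagonal ($1\le k\le\gamma_1$) is the set of boxes $(i,j)$ with $j+i(p-1)=k+p-1$. If its lowest box is in row $i$ and its highest box is in row $i-s+1$, put $v_k(\lambda)=[x_{i-s+1},x_{i-s+2}^p,\dots,x_i^{p^{s-1}}]$. Then $v(\lambda)=\prod_{k=1}^{\gamma_1}v_k(\lambda)$. $\lambda'$ is the conjugate partition of $\lambda$ and $w(\lambda')=\prod_{j=1}^{\lambda_1}w(\lambda'_j)$. *)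

theory Defs
  imports
    "HOL-Library.Poly_Mapping"
    "HOL-Computational_Algebra.Polynomial"
    "Berlekamp_Zassenhaus.Finite_Field"
    "Jordan_Normal_Form.Determinant"
begin

text \<open>
  The prime \<open>p\<close> is the cardinality of a type \<open>'p :: prime_card\<close>, and \<open>'p mod_ring\<close> is the field
  with \<open>p\<close> elements. The type \<open>'p fp_poly\<close> is the polynomial ring in the variables
  \<open>xvar i\<close> for all natural numbers \<open>i\<close>: an element is a finitely supported map from exponent vectors to
  coefficients. The ring in \<open>n\<close> variables is its subring on \<open>xvar 1, \<dots>, xvar n\<close>. The Steenrod operations
  preserve this subring and restrict to the usual ones there, since the defining conditions do not
  depend on \<open>n\<close>.
\<close>

type_synonym 'p fp_poly = "(nat \<Rightarrow>\<^sub>0 nat) \<Rightarrow>\<^sub>0 'p mod_ring"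

definition xvar :: "nat \<Rightarrow> 'p::prime_card fp_poly" where
  "xvar i = Poly_Mapping.single (Poly_Mapping.single i 1) 1"

definition Const :: "'p::prime_card mod_ring \<Rightarrow> 'p fp_poly" where
  "Const c = Poly_Mapping.single 0 c"


section \<open>Steenrod powers\<close>

definition steenrod_action :: "(nat \<Rightarrow> 'p::prime_card fp_poly \<Rightarrow> 'p fp_poly) \<Rightarrow> bool" where
  "steenrod_action P \<longleftrightarrow>
     (\<forall>r f g. P r (f + g) = P r f + P r g) \<and>
     (\<forall>r c f. P r (Const c * f) = Const c * P r f) \<and>
     (\<forall>f. P 0 f = f) \<and>
     (\<forall>i. P 1 (xvar i) = xvar i ^ CARD('p)) \<and>
     (\<forall>r i. r > 1 \<longrightarrow> P r (xvar i) = 0) \<and>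
     (\<forall>r. r > 0 \<longrightarrow> P r 1 = 0) \<and>
     (\<forall>r f g. P r (f * g) = (\<Sum>s\<le>r. P s f * P (r - s) g))"

text \<open>Existence and uniqueness are proved in \<open>ex1_steenrod_action\<close> below.\<close>

definition steenrod_P :: "nat \<Rightarrow> 'p::prime_card fp_poly \<Rightarrow> 'p fp_poly" where
  "steenrod_P = (THE P. steenrod_action P)"

text \<open>
  The action of \<open>\<chi>(P\<^sup>r)\<close> on polynomials: the relation \<open>\<Sum>\<^bsub>i+j=r\<^esub> P\<^sup>i \<chi>(P\<^sup>j) = 0\<close> is solved for
  its term with \<open>i = 0\<close>. The lemma \<open>action_chi_eq_chi_P\<close> below shows that this is how \<open>\<chi>(P\<^sup>r)\<close> acts,
  for any algebra acting through the Steenrod powers and any \<open>\<chi>\<close> satisfying the relations.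
\<close>

fun chi_P :: "nat \<Rightarrow> 'p::prime_card fp_poly \<Rightarrow> 'p fp_poly" where
  "chi_P r f = (if r = 0 then f else - (\<Sum>i\<in>{1..r}. steenrod_P i (chi_P (r - i) f)))"

declare chi_P.simps [simp del]

definition P_hat :: "nat \<Rightarrow> 'p::prime_card fp_poly \<Rightarrow> 'p fp_poly" where
  "P_hat r f = (-1) ^ r * chi_P r f"


section \<open>Partitions\<close>

text \<open>
  A partition \<open>(\<lambda>\<^sub>1, \<dots>, \<lambda>\<^sub>n)\<close> is a list of length \<open>n\<close>; \<open>part L i\<close> is \<open>\<lambda>\<^sub>i\<close>, counted from \<open>1\<close>, and
  \<open>0\<close> outside \<open>{1..n}\<close>.
\<close>

definition part :: "nat list \<Rightarrow> nat \<Rightarrow> nat" where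
  "part L i = (if 1 \<le> i \<and> i \<le> length L then L ! (i - 1) else 0)"

definition column_regular :: "nat \<Rightarrow> nat list \<Rightarrow> bool" where
  "column_regular p L \<longleftrightarrow>
     (\<forall>i\<in>{1..length L}. part L (i + 1) \<le> part L i \<and> part L i - part L (i + 1) \<le> p - 1)"

definition T_regular :: "nat \<Rightarrow> nat list \<Rightarrow> bool" where
  "T_regular p L \<longleftrightarrow> column_regular p L \<and>
     (\<forall>a\<ge>1. \<forall>i\<in>{1..length L}. \<forall>i'\<in>{1..length L}.
        (a - 1) * (p - 1) < part L i \<and> part L i < a * (p - 1) \<and>
        (a - 1) * (p - 1) < part L i' \<and> part L i' < a * (p - 1) \<longrightarrow> i = i')"

definition diagram :: "nat list \<Rightarrow> (nat \<times> nat) set" where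
  "diagram L = {(i, j). 1 \<le> i \<and> i \<le> length L \<and> 1 \<le> j \<and> j \<le> part L i}"

definition T_conjugate :: "nat \<Rightarrow> nat list \<Rightarrow> nat \<Rightarrow> nat" where
  "T_conjugate p L k = card {(i, j) \<in> diagram L. (k - 1) * (p - 1) < j \<and> j \<le> k * (p - 1)}"

definition T_conjugate_length :: "nat \<Rightarrow> nat list \<Rightarrow> nat" where
  "T_conjugate_length p L = card {k. k \<ge> 1 \<and> T_conjugate p L k \<noteq> 0}"

definition conjugate_part :: "nat list \<Rightarrow> nat \<Rightarrow> nat" where
  "conjugate_part L j = card {i \<in> {1..length L}. j \<le> part L i}"

definition antidiagonal :: "nat \<Rightarrow> nat list \<Rightarrow> nat \<Rightarrow> (nat \<times> nat) set" where
  "antidiagonal p L k = {(i, j) \<in> diagram L. j + i * (p - 1) = k + (p - 1)}"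

text \<open>\<open>(p\<^sup>k - 1) / (p - 1)\<close>; the division is exact.\<close>

definition p_num :: "nat \<Rightarrow> nat \<Rightarrow> nat" where
  "p_num p k = (p ^ k - 1) div (p - 1)"


section \<open>The polynomials \<open>v(\<lambda>)\<close> and \<open>w(\<lambda>')\<close>\<close>

text \<open>The list \<open>[(i\<^sub>1, s\<^sub>1), \<dots>, (i\<^sub>k, s\<^sub>k)]\<close> stands for the bracket with entries \<open>x\<close> at index \<open>i\<^sub>b\<close>
  raised to \<open>s\<^sub>a\<close>.\<close>

definition bracket :: "(nat \<times> nat) list \<Rightarrow> 'p::prime_card fp_poly" where
  "bracket xs =
     det (mat (length xs) (length xs) (\<lambda>(a, b). xvar (fst (xs ! b)) ^ snd (xs ! a)))"

definition w_poly :: "nat \<Rightarrow> 'p::prime_card fp_poly" where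
  "w_poly k = bracket (map (\<lambda>a. (a + 1, CARD('p) ^ a)) [0..<k])"

text \<open>Row indices increase downwards, so the highest box has the least row index \<open>i - s + 1\<close> and the
  lowest box the greatest row index \<open>i\<close>.\<close>

definition v_antidiagonal :: "nat list \<Rightarrow> nat \<Rightarrow> 'p::prime_card fp_poly" where
  "v_antidiagonal L k =
     (let rows = fst ` antidiagonal CARD('p) L k; top_row = Min rows; bottom_row = Max rows
      in bracket (map (\<lambda>a. (top_row + a, CARD('p) ^ a)) [0..<bottom_row + 1 - top_row]))"

definition v_poly :: "nat list \<Rightarrow> 'p::prime_card fp_poly" where
  "v_poly L = (\<Prod>k\<in>{1..T_conjugate CARD('p) L 1}. v_antidiagonal L k)"

definition w_conj_poly :: "nat list \<Rightarrow> 'p::prime_card fp_poly" where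
  "w_conj_poly L = (\<Prod>j\<in>{1..part L 1}. w_poly (conjugate_part L j))"


section \<open>Existence and uniqueness of the Steenrod powers\<close>

lemma xvar_power: "xvar i ^ k = Poly_Mapping.single (Poly_Mapping.single i k) 1"
  by (induction k) (auto simp: xvar_def mult_single single_one simp flip: single_add)

lemma single_eq_prod_xvar:
  "(Poly_Mapping.single m c :: 'p::prime_card fp_poly) =
     Const c * (\<Prod>i\<in>Poly_Mapping.keys m. xvar i ^ Poly_Mapping.lookup m i)"
proof -
  have prod_single: "(\<Prod>i\<in>S. Poly_Mapping.single (h i) (1::'p mod_ring)) =
        Poly_Mapping.single (\<Sum>i\<in>S. h i) 1"
    if "finite S" for S and h :: "nat \<Rightarrow> nat \<Rightarrow>\<^sub>0 nat"
    using that by induction (auto simp: mult_single single_one)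
  have "(\<Sum>i\<in>Poly_Mapping.keys m. Poly_Mapping.single i (Poly_Mapping.lookup m i)) = m"
    by (rule poly_mapping_eqI) (simp add: lookup_sum lookup_single when_def in_keys_iff)
  then show ?thesis
    by (simp add: xvar_power prod_single Const_def mult_single)
qed

text \<open>Existence: \<open>P\<^sup>r f\<close> is the coefficient of \<open>t\<^sup>r\<close> in \<open>f(x\<^sub>i + x\<^sub>i\<^sup>p t)\<close>.\<close>

context
begin

private definition mon_total :: "(nat \<Rightarrow>\<^sub>0 nat) \<Rightarrow> 'p::prime_card fp_poly poly" where
  "mon_total m = (\<Prod>i\<in>Poly_Mapping.keys m. [:xvar i, xvar i ^ CARD('p):] ^ Poly_Mapping.lookup m i)"

private definition total_P :: "'p::prime_card fp_poly \<Rightarrow> 'p fp_poly poly" where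
  "total_P f = (\<Sum>m\<in>Poly_Mapping.keys f. smult (Const (Poly_Mapping.lookup f m)) (mon_total m))"

private lemma mon_total_superset:
  assumes "finite S" "Poly_Mapping.keys m \<subseteq> S"
  shows "(mon_total m :: 'p::prime_card fp_poly poly) =
    (\<Prod>i\<in>S. [:xvar i, xvar i ^ CARD('p):] ^ Poly_Mapping.lookup m i)"
  unfolding mon_total_def
  by (rule prod.mono_neutral_left) (use assms in \<open>auto simp: in_keys_iff\<close>)

private lemma total_superset:
  assumes "finite S" "Poly_Mapping.keys f \<subseteq> S"
  shows "total_P f = (\<Sum>m\<in>S. smult (Const (Poly_Mapping.lookup f m)) (mon_total m))"
  unfolding total_P_def
  by (rule sum.mono_neutral_left) (use assms in \<open>auto simp: in_keys_iff Const_def\<close>)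

private lemma mon_total_add:
  "(mon_total (m + n) :: 'p::prime_card fp_poly poly) = mon_total m * mon_total n"
proof -
  let ?S = "Poly_Mapping.keys m \<union> Poly_Mapping.keys n"
  have "(mon_total l :: 'p fp_poly poly) =
      (\<Prod>i\<in>?S. [:xvar i, xvar i ^ CARD('p):] ^ Poly_Mapping.lookup l i)"
    if "Poly_Mapping.keys l \<subseteq> ?S" for l
    by (rule mon_total_superset) (use that in auto)
  from this[of m] this[of n] this[of "m + n", OF keys_add] show ?thesis
    by (simp only: lookup_add power_add prod.distrib Un_upper1 Un_upper2)
qed

private lemma total_add: "total_P (f + g) = total_P f + total_P g"
proof -
  let ?S = "Poly_Mapping.keys f \<union> Poly_Mapping.keys g"
  have "total_P h = (\<Sum>m\<in>?S. smult (Const (Poly_Mapping.lookup h m)) (mon_total m))"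
    if "Poly_Mapping.keys h \<subseteq> ?S" for h
    by (rule total_superset) (use that in auto)
  from this[of f] this[of g] this[of "f + g", OF keys_add] show ?thesis
    by (simp add: lookup_add Const_def single_add smult_add_left sum.distrib)
qed

private lemma total_single: "total_P (Poly_Mapping.single m c) = smult (Const c) (mon_total m)"
  using total_superset[of "{m}" "Poly_Mapping.single m c"] by simp

lemma fp_poly_induct [case_names single add]:
  fixes f :: "'p::prime_card fp_poly"
  assumes "\<And>m c. Q (Poly_Mapping.single m c)"
    and "\<And>f g. Q f \<Longrightarrow> Q g \<Longrightarrow> Q (f + g)"
  shows "Q f"
proof -
  have Q0: "Q 0" using assms(1)[of 0 0] by simp
  have "Q (\<Sum>m\<in>S. Poly_Mapping.single m (Poly_Mapping.lookup f m))" if "finite S" for S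
    using that by induction (auto simp: Q0 assms)
  moreover have "(\<Sum>m\<in>Poly_Mapping.keys f. Poly_Mapping.single m (Poly_Mapping.lookup f m)) = f"
    by (rule poly_mapping_eqI) (simp add: lookup_sum lookup_single when_def in_keys_iff)
  ultimately show ?thesis by (metis finite_keys)
qed

private lemma total_mult: "total_P (f * g) = total_P f * total_P g"
proof (induction f rule: fp_poly_induct)
  case (single m c)
  show ?case
  proof (induction g rule: fp_poly_induct)
    case (single n d)
    have "Const c * Const d = Const (c * d)" by (simp add: Const_def mult_single)
    then show ?case by (simp add: mult_single total_single mon_total_add mult.commute)
  next
    case (add g h)
    then show ?case by (simp add: distrib_left total_add)
  qed
next
  case (add f h)
  then show ?case by (simp add: distrib_right total_add)
qed

private lemma total_Const: "total_P (Const c :: 'p::prime_card fp_poly) = [:Const c:]"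
proof -
  have "mon_total (0::nat \<Rightarrow>\<^sub>0 nat) = (1::'p fp_poly poly)"
    by (simp add: mon_total_def)
  then show ?thesis
    unfolding Const_def total_single by (simp add: smult_one)
qed

lemma Const_1: "Const 1 = 1"
  by (simp add: Const_def single_one)

private lemma total_xvar:
  "total_P (xvar i :: 'p::prime_card fp_poly) = [:xvar i, xvar i ^ CARD('p):]"
proof -
  have "total_P (xvar i :: 'p fp_poly) = smult (Const 1) (mon_total (Poly_Mapping.single i 1))"
    unfolding xvar_def by (rule total_single)
  also have "\<dots> = [:xvar i :: 'p fp_poly, xvar i ^ CARD('p):]"
    by (simp add: Const_1 mon_total_def)
  finally show ?thesis .
qed

private lemma constant_term_total: "coeff (total_P f) 0 = f"
proof (induction f rule: fp_poly_induct)
  case (single m c)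
  show ?case
    unfolding total_single unfolding single_eq_prod_xvar
    by (simp add: mon_total_def poly_prod flip: poly_0_coeff_0)
qed (simp add: total_add)

lemma steenrod_action_exists:
  "\<exists>P :: nat \<Rightarrow> 'p::prime_card fp_poly \<Rightarrow> 'p fp_poly. steenrod_action P"
proof
  show "steenrod_action (\<lambda>r (f :: 'p fp_poly). coeff (total_P f) r)"
    unfolding steenrod_action_def
  proof (intro conjI allI impI)
    fix r :: nat assume "r > 0"
    then show "coeff (total_P (1 :: 'p fp_poly)) r = 0"
      using total_Const[where 'p = 'p, of 1] by (cases r) (simp_all add: Const_1)
  qed (auto simp: total_add total_mult total_Const total_xvar constant_term_total coeff_mult
      coeff_pCons split: nat.splits)
qed

end

lemma steenrod_action_add: "steenrod_action P \<Longrightarrow> P r (f + g) = P r f + P r g"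
  unfolding steenrod_action_def by (drule conjunct1) blast

lemma steenrod_action_Const: "steenrod_action P \<Longrightarrow> P r (Const c * f) = Const c * P r f"
  unfolding steenrod_action_def by (drule conjunct2, drule conjunct1) blast

lemma steenrod_action_unique:
  fixes P Q :: "nat \<Rightarrow> 'p::prime_card fp_poly \<Rightarrow> 'p fp_poly"
  assumes P: "steenrod_action P" and Q: "steenrod_action Q"
  shows "P = Q"
proof -
  define agree where "agree f \<longleftrightarrow> (\<forall>r. P r f = Q r f)" for f
  have one: "agree 1"
    unfolding agree_def
  proof
    fix r show "P r 1 = Q r 1"
      using P Q unfolding steenrod_action_def by (cases "r = 0") auto
  qed
  have xvar: "agree (xvar i)" for i
    unfolding agree_def
  proof
    fix r :: nat
    consider "r = 0" | "r = 1" | "r > 1" by linarith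
    then show "P r (xvar i) = Q r (xvar i)"
      using P Q unfolding steenrod_action_def by cases auto
  qed
  have mult: "agree (f * g)" if "agree f" "agree g" for f g
  proof -
    have "P r (f * g) = (\<Sum>s\<le>r. P s f * P (r - s) g)" for r
      using P unfolding steenrod_action_def by blast
    moreover have "Q r (f * g) = (\<Sum>s\<le>r. Q s f * Q (r - s) g)" for r
      using Q unfolding steenrod_action_def by blast
    ultimately show ?thesis using that unfolding agree_def by simp
  qed
  have power: "agree (xvar i ^ k)" for i k
    by (induction k) (auto intro: one xvar mult)
  have prod: "agree (\<Prod>i\<in>S. xvar i ^ h i)" if "finite S" for S and h :: "nat \<Rightarrow> nat"
    using that by induction (auto intro: one power mult)
  have "agree f" for f
  proof (induction f rule: fp_poly_induct)
    case (single m c)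
    have "P r (Const c * g) = Const c * P r g" "Q r (Const c * g) = Const c * Q r g" for r g
      using steenrod_action_Const P Q by auto
    then have Const: "agree (Const c * g)" if "agree g" for g
      using that unfolding agree_def by simp
    show ?case
      unfolding single_eq_prod_xvar by (rule Const, rule prod, rule finite_keys)
  next
    case (add f g)
    have "P r (f + g) = P r f + P r g" "Q r (f + g) = Q r f + Q r g" for r
      using steenrod_action_add P Q by auto
    with add show ?case unfolding agree_def by simp
  qed
  then show ?thesis unfolding agree_def by blast
qed

lemma ex1_steenrod_action:
  "\<exists>!P :: nat \<Rightarrow> 'p::prime_card fp_poly \<Rightarrow> 'p fp_poly. steenrod_action P"
  using steenrod_action_exists steenrod_action_unique by blast

lemma steenrod_action_steenrod_P: "steenrod_action steenrod_P"
  unfolding steenrod_P_def using ex1_steenrod_action by (rule theI')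

lemma steenrod_P_0: "steenrod_P 0 f = f"
  using steenrod_action_steenrod_P unfolding steenrod_action_def by blast

lemma sum_steenrod_P_chi_P:
  assumes "r \<ge> 1"
  shows "(\<Sum>i\<le>r. steenrod_P i (chi_P (r - i) f)) = 0"
proof -
  have "{..r} = insert 0 {1..r}" by auto
  then show ?thesis
    using assms chi_P.simps[of r f] by (simp add: steenrod_P_0)
qed

lemma action_chi_eq_chi_P:
  fixes act :: "'a::ring_1 \<Rightarrow> 'p::prime_card fp_poly \<Rightarrow> 'p fp_poly"
    and P :: "nat \<Rightarrow> 'a" and \<chi> :: "'a \<Rightarrow> 'a"
  assumes act_1: "\<And>f. act 1 f = f"
    and act_add: "\<And>a b f. act (a + b) f = act a f + act b f"
    and act_mult: "\<And>a b f. act (a * b) f = act a (act b f)"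
    and act_P: "\<And>r f. act (P r) f = steenrod_P r f"
    and P_0: "P 0 = 1"
    and chi_1: "\<chi> 1 = 1"
    and chi_P: "\<And>r. r \<ge> 1 \<Longrightarrow> (\<Sum>i\<le>r. P i * \<chi> (P (r - i))) = 0"
  shows "act (\<chi> (P r)) f = chi_P r f"
proof (induction r rule: less_induct)
  case (less r)
  have act_0: "act 0 g = 0" for g
    using act_add[of 0 0 g] by (metis add_cancel_right_right add_0)
  have act_sum: "act (\<Sum>i\<in>S. h i) g = (\<Sum>i\<in>S. act (h i) g)" if "finite S"
    for S :: "nat set" and h g
    using that by induction (auto simp: act_0 act_add)
  show ?case
  proof (cases "r = 0")
    case True
    then show ?thesis by (simp add: P_0 chi_1 act_1 chi_P.simps)
  next
    case False
    then have "{..r} = insert 0 {1..r}" by auto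
    then have "0 = act (\<chi> (P r)) f + (\<Sum>i\<in>{1..r}. steenrod_P i (act (\<chi> (P (r - i))) f))"
      using arg_cong[OF chi_P, of r "\<lambda>a. act a f"] False
      by (simp add: act_0 act_add act_sum act_mult act_P P_0)
    also have "(\<Sum>i\<in>{1..r}. steenrod_P i (act (\<chi> (P (r - i))) f)) =
        (\<Sum>i\<in>{1..r}. steenrod_P i (chi_P (r - i) f))"
      by (rule sum.cong) (auto simp: less)
    finally have "act (\<chi> (P r)) f = - (\<Sum>i\<in>{1..r}. steenrod_P i (chi_P (r - i) f))"
      by (simp only: eq_neg_iff_add_eq_0)
    also have "\<dots> = chi_P r f"
      using False by (subst chi_P.simps) simp
    finally show ?thesis .
  qed
qed

end

theory Submission
  imports Defs "HOL-Computational_Algebra.Formal_Laurent_Series"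
begin

text \<open>
  The operations are evaluated all at once. The coefficients of a ring homomorphism \<open>\<Phi>\<close> from
  polynomials to power series in \<open>T\<close> are the conjugate Steenrod powers, that of index \<open>r\<close> being
  placed at the exponent \<open>r (p - 1)\<close> (\<open>hat_total\<close>). On a variable, \<open>\<Phi>(x) = x + T\<^sup>p\<^sup>-\<^sup>1 \<Phi>(x)\<^sup>p\<close>; so the
  series \<open>Y\<^sub>i = T \<Phi>(x\<^sub>i)\<close> is additive, which means that only exponents that are powers of \<open>p\<close> occur
  in it. Row operations show that the image of a bracket \<open>[x\<^sub>t, x\<^sub>t\<^sub>+\<^sub>1\<^sup>p, \<dots>, x\<^sub>i\<^sup>q]\<close>, multiplied by
  \<open>T\<^sup>q\<close>, is the determinant in which the last row is replaced by \<open>Y\<^sub>t, \<dots>, Y\<^sub>i\<close>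
  (\<open>hat_total_vbracket\<close>). Hence it is additive too, and in its expansion along the last row the
  coefficient of \<open>Y\<^sub>i\<close> is the bracket without the last variable.

  Let the first block have \<open>\<gamma>\<^sub>1 = n (p - 1) + b\<close> boxes, with \<open>1 \<le> b \<le> p - 1\<close>. There are as many
  antidiagonals, so \<open>v(\<lambda>)\<close> becomes a product of \<open>\<gamma>\<^sub>1\<close> additive series up to a power of \<open>T\<close>, and the
  exponent \<open>r\<^sub>1\<close> is such that the first operation picks the coefficient at \<open>M = (b + 1) p\<^sup>n - 1\<close>.
  The digits of \<open>M\<close> in base \<open>p\<close> are \<open>b, p - 1, \<dots>, p - 1\<close>, with sum \<open>\<gamma>\<^sub>1\<close>; therefore products of
  fewer than \<open>\<gamma>\<^sub>1\<close> additive series have no term at \<open>M\<close>. In particular a product of \<open>\<gamma>\<^sub>1\<close> of the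
  series \<open>Y\<^sub>i\<close> in which one of them occurs \<open>p\<close> times may be dropped, as \<open>Y\<^sub>i\<^sup>p\<close> is additive itself.
  Now \<open>p - 1\<close> antidiagonals end in each row but the last one of the diagram, so from top to bottom
  only the leading terms of the expansions survive (\<open>prod_mod_digits_less\<close>): what remains is the
  product of the brackets without their last variables, which is \<open>v\<close> of the diagram without its
  first block, times the coefficient of \<open>Y\<^sub>1\<^sup>p\<^sup>-\<^sup>1 \<cdots> Y\<^sub>n\<^sup>p\<^sup>-\<^sup>1 Y\<^sub>n\<^sub>+\<^sub>1\<^sup>b\<close> at \<open>M\<close>. The same argument, with the
  brackets \<open>w(k)\<close> in place of the antidiagonals, shows that this coefficient is
  \<open>w(n)\<^sup>p\<^sup>-\<^sup>1\<^sup>-\<^sup>b w(n + 1)\<^sup>b\<close> (\<open>prod_frob_series_nth\<close>), the product of the \<open>w(\<lambda>'\<^sub>j)\<close> over the columns \<open>j\<close>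
  of the first block.

  This reduces the theorem to the diagram without its first block, once the factors \<open>w(k)\<close> can be
  moved out of the later operations. They can: since the image of \<open>w(k)\<close> is additive up to a power
  of \<open>T\<close>, the operations of positive index below \<open>p\<^sup>k\<^sup>-\<^sup>1\<close> annihilate \<open>w(k)\<close>, and the exponents of
  the later operations are smaller than that (\<open>inert_w_block\<close>).
\<close>

no_notation vec_index (infixl "$" 100)

section \<open>Digit sums and additive power series\<close>

text \<open>
  A product of \<open>k\<close> additive series has terms only at sums of \<open>k\<close> powers of \<open>p\<close>, and such a sum has
  digit sum at most \<open>k\<close>. So a product of fewer than \<open>digit_sum p M\<close> additive series has no term at
  \<open>M\<close>; this is how unwanted terms are discarded below.
\<close>

fun digit_sum :: "nat \<Rightarrow> nat \<Rightarrow> nat" where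
  "digit_sum p m = (if m = 0 \<or> p < 2 then 0 else m mod p + digit_sum p (m div p))"

declare digit_sum.simps [simp del]

lemma digit_sum_0 [simp]: "digit_sum p 0 = 0"
  by (simp add: digit_sum.simps)

lemma digit_sum_rec: "p \<ge> 2 \<Longrightarrow> digit_sum p m = m mod p + digit_sum p (m div p)"
  by (cases "m = 0") (simp_all add: digit_sum.simps[of p m])

text \<open>
  A carry replaces \<open>p\<close> in one digit by \<open>1\<close> in the next one, so it can only lower the digit sum.
\<close>

lemma digit_sum_Suc_le:
  assumes "p \<ge> 2"
  shows "digit_sum p (Suc m) \<le> Suc (digit_sum p m)"
proof (induction m rule: less_induct)
  case (less m)
  have rec: "digit_sum p k = k mod p + digit_sum p (k div p)" for k
    using assms by (rule digit_sum_rec)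
  show ?case
  proof (cases "Suc (m mod p) = p")
    case True
    with assms have "m \<noteq> 0" by (cases "m = 0") simp_all
    then have "digit_sum p (Suc (m div p)) \<le> Suc (digit_sum p (m div p))"
      using assms by (intro less div_less_dividend) simp_all
    moreover have "Suc m div p = Suc (m div p)" "Suc m mod p = 0"
      using True by (simp_all add: div_Suc mod_Suc)
    ultimately show ?thesis
      by (simp add: rec[of m] rec[of "Suc m"])
  next
    case False
    then have "Suc m div p = m div p" "Suc m mod p = Suc (m mod p)"
      by (auto simp: div_Suc mod_Suc)
    then show ?thesis
      by (simp add: rec[of m] rec[of "Suc m"])
  qed
qed

lemma digit_sum_add_power_le:
  assumes "p \<ge> 2"
  shows "digit_sum p (p ^ j + m) \<le> Suc (digit_sum p m)"
proof (induction j arbitrary: m)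
  case 0
  show ?case using digit_sum_Suc_le[OF assms, of m] by simp
next
  case (Suc j)
  have "(p ^ Suc j + m) mod p = m mod p" "(p ^ Suc j + m) div p = p ^ j + m div p"
    using assms by simp_all
  then show ?case
    using Suc[of "m div p"] digit_sum_rec[OF assms, of m]
      digit_sum_rec[OF assms, of "p ^ Suc j + m"] by simp
qed

text \<open>
  In base \<open>p\<close> this number is the digit \<open>b\<close> followed by \<open>k\<close> digits \<open>p - 1\<close>. Numbers of this form
  are the degrees at which coefficients are extracted: among the numbers below \<open>p ^ (k + 1)\<close> with
  leading digit \<open>b\<close> they have the greatest digit sum.
\<close>

lemma digit_sum_pred_mult_power:
  assumes "p \<ge> 2" "b < p"
  shows "digit_sum p ((b + 1) * p ^ k - 1) = k * (p - 1) + b"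
proof (induction k)
  case 0
  show ?case using digit_sum_rec[OF assms(1), of b] assms by simp
next
  case (Suc k)
  let ?a = "(b + 1) * p ^ k - 1"
  have pos: "(b + 1) * p ^ k \<ge> 1"
    using assms by (simp only: Suc_le_eq nat_0_less_mult_iff One_nat_def) simp
  have "(b + 1) * p ^ Suc k = p * ((b + 1) * p ^ k)" by (simp only: power_Suc mult.left_commute)
  also have "(b + 1) * p ^ k = ?a + 1" using pos by (rule le_add_diff_inverse2[symmetric])
  finally have eq: "(b + 1) * p ^ Suc k - 1 = p * ?a + (p - 1)"
    using assms by (simp only: distrib_left)
  have "(p * ?a + (p - 1)) mod p = p - 1"
    using assms by (simp only: mod_mult_self4) simp
  moreover have "(p * ?a + (p - 1)) div p = ?a"
    using assms by (subst div_mult_self4) simp_all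
  ultimately show ?case
    using digit_sum_rec[OF assms(1), of "p * ?a + (p - 1)"] Suc eq by simp
qed

definition additive_fps :: "nat \<Rightarrow> 'a::zero fps \<Rightarrow> bool" where
  "additive_fps p f \<longleftrightarrow> (\<forall>M. f $ M \<noteq> 0 \<longrightarrow> (\<exists>j. M = p ^ j))"

definition digits_less :: "nat \<Rightarrow> nat \<Rightarrow> 'a::zero fps \<Rightarrow> bool" where
  "digits_less p k f \<longleftrightarrow> (\<forall>M. f $ M \<noteq> 0 \<longrightarrow> digit_sum p M < k)"

lemma additive_fps_const_mult:
  "additive_fps p f \<Longrightarrow> additive_fps p (fps_const c * f :: 'a::comm_ring_1 fps)"
  unfolding additive_fps_def by (auto dest: mult_not_zero)

lemma additive_fps_add:
  "additive_fps p f \<Longrightarrow> additive_fps p g \<Longrightarrow> additive_fps p (f + g :: 'a::comm_ring_1 fps)"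
  unfolding additive_fps_def by (metis add_0 fps_add_nth)

lemma additive_fps_sum:
  "(\<And>i. i \<in> S \<Longrightarrow> additive_fps p (f i)) \<Longrightarrow> additive_fps p (\<Sum>i\<in>S. f i :: 'a::comm_ring_1 fps)"
  by (induction S rule: infinite_finite_induct)
    (auto intro: additive_fps_add, auto simp: additive_fps_def)

lemma digits_less_const_mult:
  "digits_less p k f \<Longrightarrow> digits_less p k (fps_const c * f :: 'a::comm_ring_1 fps)"
  unfolding digits_less_def by (auto dest: mult_not_zero)

lemma digits_less_add:
  "digits_less p k f \<Longrightarrow> digits_less p k g \<Longrightarrow> digits_less p k (f + g :: 'a::comm_ring_1 fps)"
  unfolding digits_less_def by (metis add_0 fps_add_nth)

lemma digits_less_sum:
  "(\<And>i. i \<in> S \<Longrightarrow> digits_less p k (f i)) \<Longrightarrow> digits_less p k (\<Sum>i\<in>S. f i :: 'a::comm_ring_1 fps)"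
  by (induction S rule: infinite_finite_induct)
    (auto intro: digits_less_add, auto simp: digits_less_def)

lemma digits_less_mono: "digits_less p k f \<Longrightarrow> k \<le> l \<Longrightarrow> digits_less p l f"
  unfolding digits_less_def by fastforce

lemma digits_less_additive_mult:
  fixes f g :: "'a::comm_ring_1 fps"
  assumes "p \<ge> 2" "additive_fps p f" "digits_less p k g"
  shows "digits_less p (Suc k) (f * g)"
  unfolding digits_less_def
proof (intro allI impI)
  fix M assume "(f * g) $ M \<noteq> 0"
  then obtain i where i: "i \<le> M" "f $ i * g $ (M - i) \<noteq> 0"
    unfolding fps_mult_nth by (metis (no_types, lifting) atLeastAtMost_iff
        sum.not_neutral_contains_not_neutral)
  then have "f $ i \<noteq> 0" "g $ (M - i) \<noteq> 0" by auto
  then obtain j where "i = p ^ j" "digit_sum p (M - i) < k"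
    using assms unfolding additive_fps_def digits_less_def by blast
  then show "digit_sum p M < Suc k"
    using digit_sum_add_power_le[OF assms(1), of j "M - i"] i by simp
qed

lemma digits_less_prod:
  fixes f :: "'b \<Rightarrow> 'a::comm_ring_1 fps"
  assumes "p \<ge> 2" "finite S" "\<And>i. i \<in> S \<Longrightarrow> additive_fps p (f i)"
  shows "digits_less p (Suc (card S)) (\<Prod>i\<in>S. f i)"
  using assms(2,3)
proof (induction S)
  case empty
  show ?case by (auto simp: digits_less_def)
next
  case (insert i S)
  then show ?case using digits_less_additive_mult[OF assms(1), of "f i"] by simp
qed

text \<open>
  Frobenius acts on a power series by raising coefficients to the \<open>p\<close>th power and multiplying
  exponents by \<open>p\<close>. For the coefficient at \<open>M\<close> the tail of \<open>f\<close> beyond \<open>M\<close> can be split off, so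
  that the additivity of the \<open>p\<close>th power is applied to a finite sum.
\<close>

lemma fps_power_CHAR_nth_nonzero:
  fixes f :: "'a::comm_ring_1 fps"
  assumes p: "p = CHAR('a)" "prime p" and nz: "(f ^ p) $ M \<noteq> 0"
  obtains i where "M = i * p" "f $ i \<noteq> 0"
proof -
  define g where "g = (\<Sum>i\<le>M. fps_const (f $ i) * fps_X ^ i)"
  define h where "h = fps_shift (Suc M) f"
  have "f = g + fps_X ^ Suc M * h"
    by (rule fps_ext)
      (auto simp: g_def h_def fps_sum_nth fps_X_power_mult_nth if_distrib simp del: power_Suc
        cong: if_cong)
  then have "f ^ p = g ^ p + (fps_X ^ Suc M * h) ^ p"
    using p by (metis freshmans_dream semiring_char_fps)
  also have "(fps_X ^ Suc M * h) ^ p = fps_X ^ (Suc M * p) * h ^ p"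
    by (simp only: power_mult_distrib power_mult)
  also have "g ^ p = (\<Sum>i\<le>M. fps_const ((f $ i) ^ p) * fps_X ^ (i * p))"
    unfolding g_def using p
    by (subst freshmans_dream_sum) (simp_all add: power_mult_distrib fps_const_power power_mult)
  finally have "(f ^ p) $ M = (\<Sum>i\<le>M. if M = i * p then (f $ i) ^ p else 0)
      + (if M < Suc M * p then 0 else (h ^ p) $ (M - Suc M * p))"
    by (simp only: fps_add_nth fps_sum_nth fps_X_power_mult_nth fps_mult_left_const_nth
        fps_X_power_nth)
      (simp add: if_distrib cong: if_cong)
  moreover have "Suc M * 1 \<le> Suc M * p"
    using p prime_gt_0_nat[of p] by (intro mult_le_mono2) simp
  then have "M < Suc M * p" by simp
  ultimately obtain i where "M = i * p" "(f $ i) ^ p \<noteq> 0"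
    using nz by (auto elim!: sum.not_neutral_contains_not_neutral split: if_splits)
  moreover from this have "f $ i \<noteq> 0"
    using p prime_gt_0_nat[of p] by (auto simp: power_0_left)
  ultimately show thesis using that by blast
qed

lemma additive_fps_power_CHAR:
  fixes f :: "'a::comm_ring_1 fps"
  assumes "p = CHAR('a)" "prime p" "additive_fps p f"
  shows "additive_fps p (f ^ p)"
  unfolding additive_fps_def
proof (intro allI impI)
  fix M assume "(f ^ p) $ M \<noteq> 0"
  with assms(1,2) obtain i where "M = i * p" "f $ i \<noteq> 0"
    by (rule fps_power_CHAR_nth_nonzero)
  moreover from this obtain j where "i = p ^ j"
    using assms(3) unfolding additive_fps_def by blast
  ultimately have "M = p ^ Suc j" by simp
  then show "\<exists>j. M = p ^ j" by blast
qed

text \<open>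
  The solution of the recursion is \<open>c X + (c X) ^ p + (c X) ^ (p ^ 2) + \<dots>\<close>. The condition on the
  constant term excludes the other solutions, which differ from it by an element fixed by
  Frobenius.
\<close>

lemma additive_fps_if_rec:
  fixes f :: "'a::comm_ring_1 fps"
  assumes p: "p = CHAR('a)" "prime p"
    and f: "f = fps_const c * fps_X + f ^ p" and f0: "f $ 0 = 0"
  shows "additive_fps p f"
proof -
  have "\<exists>j. M = p ^ j" if "f $ M \<noteq> 0" for M
    using that
  proof (induction M rule: less_induct)
    case (less M)
    show ?case
    proof (cases "M = 1")
      case True
      then have "M = p ^ 0" by simp
      then show ?thesis by blast
    next
      case False
      have "f $ M = (fps_const c * fps_X + f ^ p) $ M" using f by simp
      also have "\<dots> = (f ^ p) $ M"
        using False by (cases M) simp_all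
      finally have "(f ^ p) $ M \<noteq> 0" using less.prems by simp
      then obtain i where i: "M = i * p" "f $ i \<noteq> 0"
        using p by (metis fps_power_CHAR_nth_nonzero)
      then have "i < M"
        using f0 prime_ge_2_nat[OF p(2)] by (cases "i = 0") auto
      then obtain j where "i = p ^ j" using less.IH i by blast
      then have "M = p ^ Suc j" using i by simp
      then show ?thesis by blast
    qed
  qed
  then show ?thesis unfolding additive_fps_def by blast
qed

section \<open>The total conjugate Steenrod power\<close>

lemma char_fp_poly [simp]: "CHAR('p::prime_card fp_poly) = CARD('p)"
proof (rule CHAR_eqI)
  have of_nat: "(of_nat n :: 'p fp_poly) = Const (of_nat n)" for n
    by (induction n) (simp_all add: Const_def single_one single_add)
  have "(of_nat n = (0 :: 'p fp_poly)) \<longleftrightarrow> CARD('p) dvd n" for n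
    unfolding of_nat Const_def
    by (metis semiring_char_mod_ring of_nat_eq_0_iff_char_dvd single_zero lookup_single_eq
        lookup_zero)
  then show "(of_nat CARD('p) :: 'p fp_poly) = 0"
    and "\<And>n. of_nat n = (0 :: 'p fp_poly) \<Longrightarrow> CARD('p) dvd n"
    by simp_all
qed

definition P_total :: "'p::prime_card fp_poly \<Rightarrow> 'p fp_poly fps" where
  "P_total f = Abs_fps (\<lambda>r. steenrod_P r f)"

text \<open>
  The total operation \<open>\<Sum> P\<^sup>r \<tau>\<^sup>r\<close>, extended from polynomials to power series so that it is linear
  over \<open>\<tau>\<close>. On series it is an injective ring endomorphism, and the defining relations of \<open>\<chi>\<close> say
  that the series \<open>\<Sum> \<chi>(P\<^sup>r)(f) \<tau>\<^sup>r\<close> is the preimage of \<open>f\<close>. Every property of this preimage below is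
  proved by applying \<open>P_extend\<close> to both sides.
\<close>

definition P_extend :: "'p::prime_card fp_poly fps \<Rightarrow> 'p fp_poly fps" where
  "P_extend F = Abs_fps (\<lambda>n. \<Sum>i\<le>n. steenrod_P i (F $ (n - i)))"

definition chi_total :: "'p::prime_card fp_poly \<Rightarrow> 'p fp_poly fps" where
  "chi_total f = Abs_fps (\<lambda>r. chi_P r f)"

lemma steenrod_P_add: "steenrod_P r (f + g) = steenrod_P r f + steenrod_P r g"
  by (rule steenrod_action_add[OF steenrod_action_steenrod_P])

lemma steenrod_P_zero [simp]: "steenrod_P r 0 = 0"
  by (metis add_cancel_right_right add_0 steenrod_P_add)

lemma steenrod_P_sum: "steenrod_P r (\<Sum>i\<in>S. h i) = (\<Sum>i\<in>S. steenrod_P r (h i))"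
  by (induction S rule: infinite_finite_induct) (simp_all add: steenrod_P_add)

lemma steenrod_P_mult: "steenrod_P r (f * g) = (\<Sum>s\<le>r. steenrod_P s f * steenrod_P (r - s) g)"
  using steenrod_action_steenrod_P unfolding steenrod_action_def by blast

lemma P_extend_add: "P_extend (F + G) = P_extend F + P_extend G"
  by (rule fps_ext) (simp add: P_extend_def steenrod_P_add sum.distrib)

text \<open>
  Both sides are the sum of \<open>P\<^sup>a(F\<^sub>b) P\<^sup>c(G\<^sub>d)\<close> over all \<open>a + b + c + d = n\<close>.
\<close>

lemma P_extend_mult: "P_extend (F * G) = P_extend F * P_extend G"
proof (rule fps_ext)
  fix n :: nat
  let ?t = "\<lambda>a b c d. steenrod_P a (F $ b) * steenrod_P c (G $ d)"
  let ?Q = "{(a, b, c, d). a + b + c + d = n}"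
  have "P_extend (F * G) $ n = (\<Sum>i\<le>n. \<Sum>j\<le>n - i. \<Sum>s\<le>i. ?t s j (i - s) (n - i - j))"
    by (simp add: P_extend_def fps_mult_nth steenrod_P_sum steenrod_P_mult atLeast0AtMost)
  also have "\<dots> = (\<Sum>(i, j, s)\<in>(SIGMA i:{..n}. {..n - i} \<times> {..i}). ?t s j (i - s) (n - i - j))"
    by (simp add: sum.Sigma sum.cartesian_product)
  also have "\<dots> = (\<Sum>(a, b, c, d)\<in>?Q. ?t a b c d)"
    by (rule sum.reindex_bij_witness[where j = "\<lambda>(i, j, s). (s, j, i - s, n - i - j)"
          and i = "\<lambda>(a, b, c, d). (a + c, b, a)"]) auto
  also have "\<dots> = (\<Sum>(m, a, c)\<in>(SIGMA m:{..n}. {..m} \<times> {..n - m}). ?t a (m - a) c (n - m - c))"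
    by (rule sum.reindex_bij_witness[where i = "\<lambda>(m, a, c). (a, m - a, c, n - m - c)"
          and j = "\<lambda>(a, b, c, d). (a + b, a, c)"]) auto
  also have "\<dots> = (P_extend F * P_extend G) $ n"
    by (simp add: P_extend_def fps_mult_nth sum.Sigma sum_product sum.cartesian_product
        atLeast0AtMost)
  finally show "P_extend (F * G) $ n = (P_extend F * P_extend G) $ n" .
qed

text \<open>
  The operation is unitriangular, because \<open>P\<^sup>0\<close> is the identity.
\<close>

lemma P_extend_inj:
  assumes "P_extend F = P_extend G"
  shows "F = G"
proof (rule fps_ext)
  fix n show "F $ n = G $ n"
  proof (induction n rule: less_induct)
    case (less n)
    have "P_extend H $ n = H $ n + (\<Sum>i\<in>{1..n}. steenrod_P i (H $ (n - i)))"
        for H :: "'a fp_poly fps"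
    proof -
      have "{..n} = insert 0 {1..n}" by auto
      then show ?thesis by (simp add: P_extend_def steenrod_P_0)
    qed
    moreover have "(\<Sum>i\<in>{1..n}. steenrod_P i (F $ (n - i))) = (\<Sum>i\<in>{1..n}. steenrod_P i (G $ (n
        - i)))"
      by (rule sum.cong) (auto simp: less)
    moreover have "P_extend F $ n = P_extend G $ n" using assms by simp
    ultimately show ?case by simp
  qed
qed

lemma P_extend_const: "P_extend (fps_const f) = P_total f"
proof (rule fps_ext)
  fix n :: nat
  have "P_extend (fps_const f) $ n = (\<Sum>i\<le>n. if i = n then steenrod_P n f else 0)"
    unfolding P_extend_def fps_nth_Abs_fps by (rule sum.cong) auto
  then show "P_extend (fps_const f) $ n = P_total f $ n" by (simp add: P_total_def)
qed

lemma P_total_1: "P_total 1 = 1"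
proof (rule fps_ext)
  fix n show "P_total 1 $ n = (1 :: 'a fp_poly fps) $ n"
    using steenrod_action_steenrod_P[where 'a = 'a]
    unfolding P_total_def steenrod_action_def by (cases n) auto
qed

lemma P_total_xvar: 
  "P_total (xvar i :: 'p::prime_card fp_poly) =
     fps_const (xvar i) + fps_const (xvar i ^ CARD('p)) * fps_X"
proof (rule fps_ext)
  fix n :: nat
  consider "n = 0" | "n = 1" | "n > 1" by linarith
  then show "P_total (xvar i) $ n = (fps_const (xvar i) + fps_const (xvar i ^ CARD('p)) * fps_X
      :: 'p fp_poly fps) $ n"
    using steenrod_action_steenrod_P[where 'a = 'p]
    unfolding P_total_def steenrod_action_def by cases (auto simp: gr0_conv_Suc)
qed

lemma P_extend_1: "P_extend 1 = 1"
  using P_extend_const[of 1] by (simp add: P_total_1)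

lemma P_extend_X: "P_extend fps_X = fps_X"
proof (rule fps_ext)
  fix n :: nat
  have "P_extend fps_X $ n = (\<Sum>i\<le>n. if i = n - 1 \<and> n > 0 then P_total (1::'a fp_poly) $ i else 0)"
    unfolding P_extend_def fps_nth_Abs_fps P_total_def by (rule sum.cong) auto
  also have "\<dots> = (if n > 0 then P_total (1::'a fp_poly) $ (n - 1) else 0)"
    by (simp cong: if_cong)
  also have "\<dots> = fps_X $ n" by (auto simp: P_total_1)
  finally show "P_extend fps_X $ n = (fps_X :: 'a fp_poly fps) $ n" .
qed

lemma P_extend_power: "P_extend (F ^ k) = P_extend F ^ k"
  by (induction k) (simp_all add: P_extend_mult P_extend_1)

lemma P_extend_chi_total: "P_extend (chi_total f) = fps_const f"
proof (rule fps_ext)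
  fix n show "P_extend (chi_total f) $ n = fps_const f $ n"
    using sum_steenrod_P_chi_P[of n f]
    by (cases "n = 0") (simp_all add: P_extend_def chi_total_def steenrod_P_0 chi_P.simps[of 0])
qed

lemma chi_total_add: "chi_total (f + g) = chi_total f + chi_total g"
  by (rule P_extend_inj) (simp add: P_extend_chi_total P_extend_add fps_const_add)

lemma chi_total_0: "chi_total 0 = 0"
  by (metis add_cancel_right_right add_0 chi_total_add)

lemma chi_total_mult: "chi_total (f * g) = chi_total f * chi_total g"
  by (rule P_extend_inj) (simp add: P_extend_chi_total P_extend_mult fps_const_mult)

lemma chi_total_1: "chi_total 1 = 1"
  by (rule P_extend_inj) (simp add: P_extend_chi_total P_extend_1)

lemma chi_total_xvar:
  "chi_total (xvar i) + fps_X * chi_total (xvar i) ^ CARD('p) =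
     fps_const (xvar i :: 'p::prime_card fp_poly)"
  by (rule P_extend_inj)
    (simp add: P_extend_add P_extend_mult P_extend_X P_extend_power P_extend_chi_total
      P_extend_const P_total_xvar mult.commute)

text \<open>
  The substitution \<open>\<tau> = - T\<^sup>p\<^sup>-\<^sup>1\<close> turns the coefficients \<open>\<chi>(P\<^sup>r)(f)\<close> into \<open>(-1)\<^sup>r \<chi>(P\<^sup>r)(f)\<close> and places
  them at the exponent by which the operation raises the degree. With this choice of exponents
  \<open>T \<Phi>(x)\<close>, where \<open>\<Phi>\<close> is \<open>hat_total\<close>, becomes a series in powers \<open>T\<^sup>q\<close> with \<open>q\<close> a power of \<open>p\<close>.
\<close>

definition hat_total :: "'p::prime_card fp_poly \<Rightarrow> 'p fp_poly fps" where
  "hat_total f = (chi_total f oo (- fps_X)) oo fps_X ^ (CARD('p) - 1)"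

lemma hat_total_nth:
  "hat_total f $ n = (if CARD('p) - 1 dvd n then P_hat (n div (CARD('p) - 1)) f else 0)"
  for f :: "'p::prime_card fp_poly"
  by (simp add: hat_total_def fps_nth_compose_X_power fps_compose_uminus' chi_total_def P_hat_def)

lemma prime_CARD: "prime CARD('p::prime_card)"
  by (rule prime_card)

lemma hat_total_const_term: "hat_total f $ 0 = f"
  by (simp add: hat_total_nth P_hat_def chi_P.simps)

lemma fps_X_power_nth_0: "(fps_X ^ (CARD('p::prime_card) - 1) :: 'p fp_poly fps) $ 0 = 0"
  using prime_ge_2_nat[OF prime_CARD[where 'p = 'p]] by simp

lemma minus_fps_X_nth_0: "(- fps_X :: 'p::prime_card fp_poly fps) $ 0 = 0"
  by simp

interpretation hat_total: comm_ring_hom "hat_total :: 'p::prime_card fp_poly \<Rightarrow> 'p fp_poly fps"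
proof
  show "hat_total (f * g) = hat_total f * hat_total g" for f g :: "'p fp_poly"
    by (simp only: hat_total_def chi_total_mult fps_compose_mult_distrib[OF minus_fps_X_nth_0]
        fps_compose_mult_distrib[OF fps_X_power_nth_0])
  show "hat_total (f + g) = hat_total f + hat_total g" for f g :: "'p fp_poly"
    by (simp only: hat_total_def chi_total_add fps_compose_add_distrib)
  show "hat_total (1 :: 'p fp_poly) = 1"
    by (simp add: hat_total_def chi_total_1)
  show "hat_total (0 :: 'p fp_poly) = 0"
    by (simp add: hat_total_def chi_total_0)
qed

lemma fps_compose_power_distrib:
  fixes a c :: "'p::prime_card fp_poly fps"
  assumes "c $ 0 = 0"
  shows "a ^ n oo c = (a oo c) ^ n"
  by (induction n) (simp_all add: fps_compose_mult_distrib[OF assms])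

text \<open>
  The image under \<open>\<tau> = - T\<^sup>p\<^sup>-\<^sup>1\<close> of \<open>chi_total_xvar\<close>, which says that the preimage \<open>c\<close> of \<open>x\<close>
  satisfies \<open>c + \<tau> c\<^sup>p = x\<close>.
\<close>

lemma hat_total_xvar:
  "hat_total (xvar i) = fps_const (xvar i :: 'p::prime_card fp_poly)
     + fps_X ^ (CARD('p) - 1) * hat_total (xvar i) ^ CARD('p)"
proof -
  let ?c = "chi_total (xvar i :: 'p fp_poly)" and ?q = "CARD('p) - 1"
  have "?c = fps_const (xvar i) - fps_X * ?c ^ CARD('p)"
    using chi_total_xvar[where 'p = 'p, of i] by (simp add: algebra_simps)
  then have "hat_total (xvar i) =
      ((fps_const (xvar i) - fps_X * ?c ^ CARD('p)) oo (- fps_X)) oo fps_X ^ ?q"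
    unfolding hat_total_def by (rule arg_cong)
  also have "\<dots> = fps_const (xvar i) + fps_X ^ ?q * hat_total (xvar i) ^ CARD('p)"
    by (simp only: hat_total_def fps_compose_sub_distrib fps_const_compose fps_compose_uminus
        fps_compose_mult_distrib[OF minus_fps_X_nth_0] fps_compose_mult_distrib[OF
            fps_X_power_nth_0]
        fps_compose_power_distrib[OF minus_fps_X_nth_0] fps_compose_power_distrib[OF
            fps_X_power_nth_0]
        fps_X_fps_compose_startby0[OF minus_fps_X_nth_0] fps_X_fps_compose_startby0[OF
            fps_X_power_nth_0]) simp
  finally show ?thesis .
qed

section \<open>The image of a bracket\<close>

text \<open>
  The additive series \<open>Y = x T + (x T) ^ p + (x T) ^ (p ^ 2) + \<dots>\<close> of the variable \<open>x\<close>. All its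
  properties are derived from the equation \<open>Y = x T + Y\<^sup>p\<close>.
\<close>

definition frob_series :: "nat \<Rightarrow> 'p::prime_card fp_poly fps" where
  "frob_series i = fps_X * hat_total (xvar i)"

lemma frob_series_rec:
  "frob_series i = fps_const (xvar i :: 'p::prime_card fp_poly) * fps_X + frob_series i ^ CARD('p)"
proof -
  have "CARD('p) = Suc (CARD('p) - 1)"
    using prime_gt_0_nat[OF prime_CARD[where 'p = 'p]] by simp
  then have "fps_X * fps_X ^ (CARD('p) - 1) = (fps_X ^ CARD('p) :: 'p fp_poly fps)"
    by (metis power_Suc)
  then have "fps_X * (fps_X ^ (CARD('p) - 1) * hat_total (xvar i) ^ CARD('p)) =
      (frob_series i ^ CARD('p) :: 'p fp_poly fps)"
    unfolding frob_series_def power_mult_distrib by (simp only: flip: mult.assoc)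
  then show ?thesis
    by (subst frob_series_def, subst hat_total_xvar) (simp only: distrib_left mult.commute)
qed

lemma additive_frob_series: "additive_fps CARD('p) (frob_series i :: 'p::prime_card fp_poly fps)"
proof (rule additive_fps_if_rec[OF _ prime_CARD frob_series_rec])
  show "(frob_series i :: 'p fp_poly fps) $ 0 = 0" by (simp add: frob_series_def)
qed simp

lemma frob_series_power_rec:
  "frob_series i ^ (CARD('p) ^ a) =
     (fps_const (xvar i :: 'p::prime_card fp_poly) * fps_X) ^ (CARD('p) ^ a) +
     frob_series i ^ (CARD('p) ^ Suc a)"
proof -
  have "frob_series i ^ (CARD('p) ^ a) =
      (fps_const (xvar i :: 'p fp_poly) * fps_X + frob_series i ^ CARD('p)) ^ (CARD('p) ^ a)"
    by (rule arg_cong[OF frob_series_rec])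
  also have "\<dots> = (fps_const (xvar i) * fps_X) ^ (CARD('p) ^ a)
      + (frob_series i ^ CARD('p)) ^ (CARD('p) ^ a)"
    by (rule freshmans_dream') (simp_all add: prime_CARD)
  finally show ?thesis by (simp only: power_Suc power_mult)
qed

lemma frob_series_telescope:
  "(\<Sum>k<a. (fps_const (xvar i :: 'p::prime_card fp_poly) * fps_X) ^ (CARD('p) ^ k))
     + frob_series i ^ (CARD('p) ^ a) = frob_series i"
proof (induction a)
  case (Suc a)
  then show ?case using frob_series_power_rec[of i a, where 'p = 'p] by (simp add: add.assoc)
qed simp

text \<open>
  The bracket \<open>[x\<^sub>t, x\<^sub>t\<^sub>+\<^sub>1\<^sup>p, \<dots>]\<close> in \<open>s\<close> consecutive variables. Both the factors of \<open>v(\<lambda>)\<close> and the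
  polynomials \<open>w(k)\<close>, for \<open>t = 1\<close>, have this form.
\<close>

definition vbracket :: "nat \<Rightarrow> nat \<Rightarrow> 'p::prime_card fp_poly" where
  "vbracket t s = bracket (map (\<lambda>a. (t + a, CARD('p) ^ a)) [0..<s])"

definition vbracket_mat :: "nat \<Rightarrow> nat \<Rightarrow> 'p::prime_card fp_poly mat" where
  "vbracket_mat t s = mat s s (\<lambda>(a, c). xvar (t + c) ^ (CARD('p) ^ a))"

lemma vbracket_eq_det: "vbracket t s = det (vbracket_mat t s)"
  unfolding vbracket_def vbracket_mat_def bracket_def
  by (rule arg_cong[where f = det]) (auto intro!: eq_matI)

lemma w_poly_eq_vbracket: "w_poly k = vbracket 1 k"
  unfolding w_poly_def vbracket_def by (simp add: add.commute)

definition series_mat :: "nat \<Rightarrow> nat \<Rightarrow> 'p::prime_card fp_poly fps mat" where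
  "series_mat t s = mat s s (\<lambda>(a, c). if a = s - 1 then frob_series (t + c)
     else fps_const (xvar (t + c) ^ (CARD('p) ^ a)))"

lemma det_scale_rows:
  fixes g :: "nat \<Rightarrow> nat \<Rightarrow> 'a::comm_ring_1"
  shows "det (mat s s (\<lambda>(a, c). d a * g a c)) = (\<Prod>a<s. d a) * det (mat s s (\<lambda>(a, c). g a c))"
proof -
  have "(\<Prod>a = 0..<s. mat s s (\<lambda>(a, c). d a * g a c) $$ (a, \<pi> a)) =
      (\<Prod>a<s. d a) * (\<Prod>a = 0..<s. mat s s (\<lambda>(a, c). g a c) $$ (a, \<pi> a))"
    if "\<pi> permutes {0..<s}" for \<pi>
  proof -
    have "\<pi> a < s" if "a < s" for a
      using permutes_in_image[OF \<open>\<pi> permutes {0..<s}\<close>, of a] that by simp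
    then show ?thesis
      by (simp add: lessThan_atLeast0 prod.distrib)
  qed
  then show ?thesis
    by (subst (1 2) det_def'[of _ s]) (auto simp: sum_distrib_left intro!: sum.cong)
qed

lemma det_unit_upper_triangular:
  assumes "A \<in> carrier_mat n n" "\<And>i. i < n \<Longrightarrow> A $$ (i, i) = 1" "upper_triangular A"
  shows "det A = (1 :: 'a::comm_ring_1)"
  using assms by (simp add: det_upper_triangular prod_list_diag_prod)

lemma det_unit_lower_triangular:
  assumes "A \<in> carrier_mat n n" "\<And>i. i < n \<Longrightarrow> A $$ (i, i) = 1"
    and "\<And>i j. i < j \<Longrightarrow> j < n \<Longrightarrow> A $$ (i, j) = 0"
  shows "det A = (1 :: 'a::comm_ring_1)"
  using assms by (simp add: det_lower_triangular[of n] prod_list_diag_prod)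

text \<open>
  Scaling row \<open>a\<close> of the matrix of \<open>\<Phi>([x\<^sub>t, x\<^sub>t\<^sub>+\<^sub>1\<^sup>p, \<dots>])\<close> by \<open>T\<^sup>q\<close>, where \<open>q = p\<^sup>a\<close>, gives the rows
  \<open>Y\<^sup>q\<close>. Since \<open>Y\<^sup>q - Y\<^sup>p\<^sup>q = (x T)\<^sup>q\<close>, subtracting from each row the next one leaves pure powers in
  all rows but the last, and adding all of these rows to the last one turns its entries back into
  \<open>Y\<close>.
\<close>

lemma hat_total_vbracket:
  "fps_X ^ (CARD('p) ^ s) * hat_total (vbracket t (Suc s)) =
     det (series_mat t (Suc s) :: 'p::prime_card fp_poly fps mat)"
proof -
  let ?n = "Suc s" and ?P = "\<lambda>a. CARD('p) ^ a"
  let ?Y = "\<lambda>c. frob_series (t + c) :: 'p fp_poly fps"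
  let ?xX = "\<lambda>c. fps_const (xvar (t + c) :: 'p fp_poly) * fps_X"
  \<comment> \<open>Up to a power of \<open>T\<close>, \<open>A0\<close> is the matrix of the image of the bracket; \<open>A1\<close> arises from it by
    subtracting the next row from each row but the last, and \<open>A2\<close> from \<open>A1\<close> by adding all rows to
    the last one. These row operations are multiplications by the unitriangular \<open>U\<close> and \<open>V\<close>.\<close>
  define A0 where "A0 = mat ?n ?n (\<lambda>(a, c). ?Y c ^ ?P a)"
  define A1 where "A1 = mat ?n ?n (\<lambda>(a, c). if a = s then ?Y c ^ ?P s else ?xX c ^ ?P a)"
  define A2 where "A2 = mat ?n ?n (\<lambda>(a, c). if a = s then ?Y c else ?xX c ^ ?P a)"
  define U where "U = mat ?n ?n (\<lambda>(a, c). if a = c then 1 else if c = Suc a then - 1 else 0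
      :: 'p fp_poly fps)"
  define V where "V = mat ?n ?n (\<lambda>(a, c). if a = c \<or> a = s then 1 else 0 :: 'p fp_poly fps)"
  have carrier: "A0 \<in> carrier_mat ?n ?n" "A1 \<in> carrier_mat ?n ?n" "U \<in> carrier_mat ?n ?n"
      "V \<in> carrier_mat ?n ?n"
    by (simp_all add: A0_def A1_def U_def V_def)
  have "det A0 = det (mat ?n ?n (\<lambda>(a, c). fps_X ^ ?P a * hat_total (xvar (t + c) ^ ?P a)))"
    unfolding A0_def frob_series_def
    by (simp add: power_mult_distrib hat_total.hom_power)
  also have "\<dots> = (\<Prod>a<?n. fps_X ^ ?P a) *
      det (mat ?n ?n (\<lambda>(a, c). hat_total (xvar (t + c) ^ ?P a :: 'p fp_poly)))"
    by (rule det_scale_rows)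
  also have "mat ?n ?n (\<lambda>(a, c). hat_total (xvar (t + c) ^ ?P a :: 'p fp_poly))
      = map_mat hat_total (vbracket_mat t ?n :: 'p fp_poly mat)"
    unfolding vbracket_mat_def by (auto intro!: eq_matI)
  finally have A0: "det A0 = (\<Prod>a<?n. fps_X ^ ?P a) * hat_total (vbracket t ?n)"
    by (simp only: hat_total.hom_det vbracket_eq_det)
  have "U * A0 = A1"
  proof (rule eq_matI)
    fix a c assume "a < dim_row A1" "c < dim_col A1"
    then have ac: "a < ?n" "c < ?n" by (simp_all add: A1_def)
    then have "(U * A0) $$ (a, c) = (\<Sum>k<?n. (if a = k then ?Y c ^ ?P k else 0)
        - (if k = Suc a then ?Y c ^ ?P k else 0))"
      by (simp add: U_def A0_def scalar_prod_def atLeast0LessThan del: sum.lessThan_Suc)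
        (intro sum.cong, auto)
    also have "\<dots> = ?Y c ^ ?P a - (if Suc a < ?n then ?Y c ^ ?P (Suc a) else 0)"
      using ac by (simp only: sum_subtractf sum.delta sum.delta' finite_lessThan lessThan_iff
          if_True)
    also have "\<dots> = A1 $$ (a, c)"
      using ac frob_series_power_rec[of "t + c" a, where 'p = 'p]
      by (auto simp: A1_def less_Suc_eq)
    finally show "(U * A0) $$ (a, c) = A1 $$ (a, c)" .
  qed (simp_all add: U_def A0_def A1_def)
  moreover have "V * A1 = A2"
  proof (rule eq_matI)
    fix a c assume "a < dim_row A2" "c < dim_col A2"
    then have ac: "a < ?n" "c < ?n" by (simp_all add: A2_def)
    show "(V * A1) $$ (a, c) = A2 $$ (a, c)"
    proof (cases "a = s")
      case True
      then have "(V * A1) $$ (a, c) = (\<Sum>k<?n. A1 $$ (k, c))"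
        using ac carrier
        by (simp add: V_def scalar_prod_def atLeast0LessThan del: sum.lessThan_Suc)
      also have "\<dots> = (\<Sum>k<s. ?xX c ^ ?P k) + ?Y c ^ ?P s"
        using ac by (simp add: A1_def)
      also have "\<dots> = A2 $$ (a, c)"
        using ac True frob_series_telescope[of "t + c" s, where 'p = 'p] by (simp add: A2_def)
      finally show ?thesis .
    next
      case False
      then have "(V * A1) $$ (a, c) = (\<Sum>k<?n. (if a = k then 1 else 0) * A1 $$ (k, c))"
        using ac carrier
        by (simp add: V_def scalar_prod_def atLeast0LessThan del: sum.lessThan_Suc)
      also have "\<dots> = A1 $$ (a, c)"
        using ac by (simp add: if_distrib[where f = "\<lambda>x. x
            * _"] del: sum.lessThan_Suc cong: if_cong)
      finally show ?thesis using ac False by (simp add: A1_def A2_def)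
    qed
  qed (simp_all add: V_def A1_def A2_def)
  moreover have "det U = 1"
    by (rule det_unit_upper_triangular[OF carrier(3)]) (auto simp: U_def)
  moreover have "det V = 1"
    by (rule det_unit_lower_triangular[OF carrier(4)]) (auto simp: V_def)
  ultimately have "det A0 = det A2"
    using det_mult[OF carrier(3,1)] det_mult[OF carrier(4,2)] by simp
  also have "A2 = mat ?n ?n (\<lambda>(a, c). (if a = s then 1 else fps_X ^ ?P a) *
      (if a = ?n - 1 then frob_series (t + c) else fps_const (xvar (t + c) ^ ?P a)))"
    unfolding A2_def
    by (rule eq_matI) (auto simp: power_mult_distrib fps_const_power)
  also have "det \<dots> = (\<Prod>a<?n. if a = s then 1 else fps_X ^ ?P a) * det (series_mat t ?n)"
    unfolding series_mat_def by (rule det_scale_rows)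
  also have "(\<Prod>a<?n. if a = s then 1 else fps_X ^ ?P a) = (\<Prod>a<s. fps_X ^ ?P a :: 'p fp_poly fps)"
    by simp
  finally have "(\<Prod>a<s. fps_X ^ ?P a) * (fps_X ^ ?P s * hat_total (vbracket t ?n)) =
      (\<Prod>a<s. fps_X ^ ?P a) * det (series_mat t ?n :: 'p fp_poly fps mat)"
    using A0 by (simp add: mult.assoc)
  moreover have "(\<Prod>a<s. fps_X ^ ?P a) \<noteq> (0 :: 'p fp_poly fps)"
    by simp
  ultimately show ?thesis using mult_left_cancel by blast
qed

interpretation fps_const_hom: comm_ring_hom "fps_const :: 'a::comm_ring_1 \<Rightarrow> 'a fps"
  by standard simp_all

text \<open>
  Expansion along the last row. The coefficient of the series of the last variable is the bracket
  in the remaining variables, which is what an antidiagonal contributes after its lowest box is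
  removed.
\<close>

lemma det_series_mat_expand:
  obtains c where "det (series_mat t (Suc s) :: 'p::prime_card fp_poly fps mat) =
    fps_const (vbracket t s) * frob_series (t + s) + (\<Sum>j<s. fps_const (c j) * frob_series (t + j))"
proof
  let ?M = "series_mat t (Suc s) :: 'p fp_poly fps mat"
  let ?N = "vbracket_mat t (Suc s) :: 'p fp_poly mat"
  have "mat_delete ?M s j = map_mat fps_const (mat_delete ?N s j)" for j
    unfolding mat_delete_def series_mat_def vbracket_mat_def by (auto intro!: eq_matI)
  then have cof: "cofactor ?M s j = fps_const (cofactor ?N s j)" for j
    unfolding cofactor_def by (simp only: fps_const_hom.hom_det fps_const_hom.hom_mult
        fps_const_hom.hom_power fps_const_hom.hom_uminus fps_const_hom.hom_one)
  have "mat_delete ?N s s = vbracket_mat t s"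
    unfolding mat_delete_def vbracket_mat_def by (auto intro!: eq_matI)
  then have corner: "cofactor ?N s s = vbracket t s"
    unfolding cofactor_def by (simp add: vbracket_eq_det)
  have "det ?M = (\<Sum>j<Suc s. ?M $$ (s, j) * cofactor ?M s j)"
    by (rule laplace_expansion_row) (simp_all add: series_mat_def)
  also have "\<dots> = (\<Sum>j<Suc s. fps_const (cofactor ?N s j) * frob_series (t + j))"
  proof (rule sum.cong)
    fix j assume "j \<in> {..<Suc s}"
    then have "?M $$ (s, j) = frob_series (t + j)" by (simp add: series_mat_def)
    then show "?M $$ (s, j) * cofactor ?M s j = fps_const (cofactor ?N s j) * frob_series (t + j)"
      by (simp add: cof mult.commute)
  qed simp
  finally show "det ?M = fps_const (vbracket t s) * frob_series (t + s) +
      (\<Sum>j<s. fps_const (cofactor ?N s j) * frob_series (t + j))"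
    by (simp add: corner add.commute)
qed

lemma additive_det_series_mat:
  "additive_fps CARD('p) (det (series_mat t (Suc s) :: 'p::prime_card fp_poly fps mat))"
proof -
  obtain c where "det (series_mat t (Suc s) :: 'p fp_poly fps mat) =
    fps_const (vbracket t s) * frob_series (t + s) + (\<Sum>j<s. fps_const (c j) * frob_series (t + j))"
    by (rule det_series_mat_expand)
  then show ?thesis
    by (auto intro!: additive_fps_add additive_fps_sum additive_fps_const_mult additive_frob_series)
qed

section \<open>Extraction of an extremal coefficient\<close>

text \<open>
  The first \<open>k\<close> factors contain \<open>Z b\<close> at least \<open>p - 1\<close> times, so together with the additional
  factor they contain \<open>(Z b)\<^sup>p\<close>. This is again additive, so that the product counts as one of at
  most \<open>k\<close> additive series instead of \<open>k + 1\<close>.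
\<close>

lemma prod_repeated_row:
  fixes Z :: "nat \<Rightarrow> 'a::comm_ring_1 fps"
  assumes p: "p = CHAR('a)" "prime p" and Z: "\<And>b. additive_fps p (Z b)"
    and b: "b < k div (p - 1)"
  shows "digits_less p (Suc k) ((\<Prod>i<k. Z (i div (p - 1))) * Z b)"
proof -
  have p2: "p \<ge> 2" using p prime_ge_2_nat by blast
  let ?q = "p - 1"
  define S where "S = {b * ?q..<b * ?q + ?q}"
  have "Suc b * ?q \<le> k div ?q * ?q" using b by (intro mult_le_mono1) simp
  also have "\<dots> \<le> k" by simp
  finally have S: "S \<subseteq> {..<k}" "finite S" unfolding S_def by auto
  have "i div ?q = b" if "i \<in> S" for i
    using that unfolding S_def by (intro div_nat_eqI) (simp_all only: mult_Suc atLeastLessThan_iff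
        mult.commute add.commute)
  then have "(\<Prod>i\<in>S. Z (i div ?q)) = Z b ^ ?q" by (simp add: S_def)
  moreover have "(\<Prod>i<k. Z (i div ?q)) = (\<Prod>i\<in>{..<k} - S. Z (i div ?q)) * (\<Prod>i\<in>S. Z (i div ?q))"
    using S by (intro prod.subset_diff) auto
  moreover have "Z b ^ ?q * Z b = Z b ^ p"
    using p2 by (metis Suc_diff_1 gr0I not_numeral_le_zero power_Suc2)
  ultimately have eq: "(\<Prod>i<k. Z (i div ?q)) * Z b = Z b ^ p * (\<Prod>i\<in>{..<k} - S. Z (i div ?q))"
    by (metis (no_types, lifting) mult.assoc mult.commute)
  have "digits_less p (Suc (Suc (card ({..<k} - S)))) (Z b ^ p * (\<Prod>i\<in>{..<k} - S. Z (i div ?q)))"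
    using Z p p2
    by (intro digits_less_additive_mult digits_less_prod additive_fps_power_CHAR) auto
  moreover have "card S \<le> k" using card_mono[OF _ S(1)] by simp
  then have "Suc (Suc (card ({..<k} - S))) \<le> Suc k"
    using S p2 by (simp add: card_Diff_subset) (simp add: S_def)
  ultimately show ?thesis unfolding eq by (rule digits_less_mono)
qed

text \<open>
  Triangularity: each factor \<open>y k\<close> is a multiple of the series of its own row plus series of
  earlier rows, and by the time \<open>y k\<close> is reached, all earlier rows already occur \<open>p - 1\<close> times. By
  \<open>prod_repeated_row\<close> the terms that use an earlier row have too few additive factors to matter.
\<close>

lemma prod_mod_digits_less:
  fixes Z y :: "nat \<Rightarrow> 'a::comm_ring_1 fps" and c :: "nat \<Rightarrow> nat \<Rightarrow> 'a"
  assumes p: "p = CHAR('a)" "prime p" and Z: "\<And>b. additive_fps p (Z b)"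
    and y: "\<And>k. k < K \<Longrightarrow> y k = fps_const (u k) * Z (k div (p - 1)) + (\<Sum>j\<in>J k. fps_const (c k j)
        * Z (b k j))"
    and b: "\<And>k j. k < K \<Longrightarrow> j \<in> J k \<Longrightarrow> b k j < k div (p - 1)"
  shows "digits_less p K ((\<Prod>k<K. y k) - fps_const (\<Prod>k<K. u k) * (\<Prod>k<K. Z (k div (p - 1))))"
  using y b
proof (induction K)
  case 0
  show ?case by (simp add: digits_less_def)
next
  case (Suc K)
  have p2: "p \<ge> 2" using p prime_ge_2_nat by blast
  let ?Z = "\<Prod>k<K. Z (k div (p - 1))" and ?u = "fps_const (\<Prod>k<K. u k)"
  let ?e = "\<Sum>j\<in>J K. fps_const (c K j) * Z (b K j)"
  have "additive_fps p (y K)"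
    using Suc.prems(1)[of K] Z
    by (auto intro!: additive_fps_add additive_fps_sum additive_fps_const_mult)
  then have 1: "digits_less p (Suc K) (y K * ((\<Prod>k<K. y k) - ?u * ?Z))"
    using Suc p2 by (intro digits_less_additive_mult) auto
  have "?u * (?Z * ?e) = ?u * (\<Sum>j\<in>J K. fps_const (c K j) * (?Z * Z (b K j)))"
    by (simp add: sum_distrib_left mult_ac)
  then have 2: "digits_less p (Suc K) (?u * (?Z * ?e))"
    using Suc.prems(2)[of K] prod_repeated_row[where Z = Z, OF p Z]
    by (simp add: digits_less_const_mult digits_less_sum)
  have "(\<Prod>k<Suc K. y k) - fps_const (\<Prod>k<Suc K. u k) * (\<Prod>k<Suc K. Z (k div (p - 1))) =
      y K * ((\<Prod>k<K. y k) - ?u * ?Z) + ?u * (?Z * ?e)"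
    using Suc.prems(1)[of K] by (simp add: algebra_simps flip: fps_const_mult)
  with digits_less_add[OF 1 2] show ?case by simp
qed

lemma prod_nth_eq:
  fixes Z y :: "nat \<Rightarrow> 'a::comm_ring_1 fps" and c :: "nat \<Rightarrow> nat \<Rightarrow> 'a"
  assumes p: "p = CHAR('a)" "prime p" and Z: "\<And>b. additive_fps p (Z b)"
    and y: "\<And>k. k < K \<Longrightarrow> y k = fps_const (u k) * Z (k div (p - 1)) + (\<Sum>j\<in>J k. fps_const (c k j)
        * Z (b k j))"
    and b: "\<And>k j. k < K \<Longrightarrow> j \<in> J k \<Longrightarrow> b k j < k div (p - 1)"
    and M: "digit_sum p M = K"
  shows "(\<Prod>k<K. y k) $ M = (\<Prod>k<K. u k) * (\<Prod>k<K. Z (k div (p - 1))) $ M"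
proof -
  let ?d = "(\<Prod>k<K. y k) - fps_const (\<Prod>k<K. u k) * (\<Prod>k<K. Z (k div (p - 1)))"
  have "digits_less p K ?d"
    by (rule prod_mod_digits_less[OF p Z y b])
  then have "?d $ M = 0" using M unfolding digits_less_def by blast
  then show ?thesis by simp
qed

lemma prod_div_blocks:
  fixes f :: "nat \<Rightarrow> 'a::comm_monoid_mult"
  assumes "q > 0" "b \<le> q"
  shows "(\<Prod>k<n * q + b. f (k div q)) = (\<Prod>i<n. f i) ^ q * f n ^ b"
proof -
  have *: "(\<Prod>k<n * q + b. f (k div q)) = (\<Prod>k<n * q. f (k div q)) * f n ^ b" if "b \<le> q" for n b
    using that
  proof (induction b)
    case (Suc b)
    have "(n * q + b) div q = n" using Suc.prems by simp
    then show ?case using Suc by (simp add: mult_ac)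
  qed simp
  have "(\<Prod>k<n * q. f (k div q)) = (\<Prod>i<n. f i) ^ q" for n
  proof (induction n)
    case (Suc n)
    then show ?case using *[of q n] by (simp add: power_mult_distrib add.commute)
  qed simp
  then show ?thesis using *[OF assms(2)] by simp
qed

lemma sum_power_div:
  assumes "p \<ge> 2" "b \<le> p - 1"
  shows "(\<Sum>k<n * (p - 1) + b. p ^ (k div (p - 1))) = (b + 1) * p ^ n - 1"
proof -
  have 1: "(\<Sum>k<n * (p - 1) + b. p ^ (k div (p - 1))) = (\<Sum>k<n * (p - 1). p ^ (k div (p - 1))) + b
      * p ^ n"
    if "b \<le> p - 1" for n b
    using that
  proof (induction b)
    case (Suc b)
    have "(n * (p - 1) + b) div (p - 1) = n" using Suc.prems by simp
    then show ?case using Suc by simp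
  qed simp
  have 2: "(\<Sum>k<n * (p - 1). p ^ (k div (p - 1))) + 1 = p ^ n" for n
  proof (induction n)
    case (Suc n)
    have "Suc n * (p - 1) = n * (p - 1) + (p - 1)" by simp
    then have "(\<Sum>k<Suc n * (p - 1). p ^ (k div (p - 1))) + 1 = p ^ n + (p - 1) * p ^ n"
      using 1[of "p - 1" n] Suc by (simp only:)
    also have "\<dots> = (1 + (p - 1)) * p ^ n" by (simp only: distrib_right mult_1)
    also have "\<dots> = p ^ Suc n" using assms by simp
    finally show ?case .
  qed simp
  have "(\<Sum>k<n * (p - 1) + b. p ^ (k div (p - 1))) + 1 = (b + 1) * p ^ n"
    using 1[OF assms(2), of n] 2[of n] by simp
  then show ?thesis by simp
qed

text \<open>
  The monomial \<open>x\<^sub>1 x\<^sub>2 ^ p x\<^sub>3 ^ (p ^ 2) \<dots>\<close> occurs in the Leibniz expansion for the identity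
  permutation only, because the exponents \<open>1, p, p\<^sup>2, \<dots>\<close> are distinct.
\<close>

lemma vbracket_1_nonzero: "vbracket 1 k \<noteq> (0 :: 'p::prime_card fp_poly)"
proof -
  let ?P = "\<lambda>a. CARD('p) ^ a"
  define mon where "mon \<pi> = (\<Sum>a<k. Poly_Mapping.single (Suc (\<pi> a)) (?P a))" for \<pi> :: "nat \<Rightarrow> nat"
  have prod: "(\<Prod>a<k. xvar (Suc (\<pi> a)) ^ ?P a :: 'p fp_poly) = Poly_Mapping.single (mon \<pi>) 1" for \<pi>
    unfolding mon_def by (induction k) (simp_all add: xvar_power mult_single single_one)
  have "vbracket 1 k = (\<Sum>\<pi> | \<pi> permutes {0..<k}. signof \<pi> * (\<Prod>a = 0..<k. vbracket_mat 1 k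
      $$ (a, \<pi> a)) :: 'p fp_poly)"
    unfolding vbracket_eq_det by (rule det_def') (simp add: vbracket_mat_def)
  also have "\<dots> = (\<Sum>\<pi> | \<pi> permutes {0..<k}. Poly_Mapping.single (mon \<pi>) (signof \<pi>))"
  proof (rule sum.cong)
    fix \<pi> assume "\<pi> \<in> {\<pi>. \<pi> permutes {0..<k}}"
    then have "\<pi> a < k" if "a < k" for a
      using permutes_in_image[of \<pi> "{0..<k}" a] that by simp
    then have "(\<Prod>a = 0..<k. vbracket_mat 1 k $$ (a, \<pi> a) :: 'p fp_poly)
        = Poly_Mapping.single (mon \<pi>) 1"
      unfolding prod[symmetric] by (simp add: vbracket_mat_def lessThan_atLeast0)
    then show "signof \<pi> * (\<Prod>a = 0..<k. vbracket_mat 1 k $$ (a, \<pi> a) :: 'p fp_poly) =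
        Poly_Mapping.single (mon \<pi>) (signof \<pi>)"
      by (simp add: sign_def single_uminus)
  qed simp
  finally have "Poly_Mapping.lookup (vbracket 1 k :: 'p fp_poly) (mon id) =
      (\<Sum>\<pi> | \<pi> permutes {0..<k}. if \<pi> = id then 1 else 0)"
  proof (simp only: lookup_sum, intro sum.cong refl)
    fix \<pi> assume "\<pi> \<in> {\<pi>. \<pi> permutes {0..<k}}"
    then have \<pi>: "\<pi> permutes {0..<k}" by simp
    have "\<pi> = id" if eq: "mon \<pi> = mon id"
    proof
      fix a show "\<pi> a = id a"
      proof (cases "a < k")
        case True
        have "Poly_Mapping.lookup (mon \<sigma>) (Suc (\<sigma> a)) = ?P a" if "\<sigma> permutes {0..<k}" for \<sigma>
        proof -
          have "Poly_Mapping.lookup (mon \<sigma>) (Suc (\<sigma> a)) = (\<Sum>c<k. if c = a then ?P c else 0)"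
            unfolding mon_def lookup_sum
            by (rule sum.cong) (auto simp: lookup_single when_def dest: permutes_inj[OF that, THEN
                injD])
          then show ?thesis using True by simp
        qed
        note lookup = this
        have "\<pi> a < k" using permutes_in_image[OF \<pi>, of a] True by simp
        have "Poly_Mapping.lookup (mon id) (Suc (id (\<pi> a))) = ?P (\<pi> a)"
        proof -
          have "Poly_Mapping.lookup (mon id) (Suc (\<pi> a)) = (\<Sum>c<k. if c = \<pi> a then ?P c else 0)"
            unfolding mon_def lookup_sum
            by (rule sum.cong) (auto simp: lookup_single when_def)
          then show ?thesis using \<open>\<pi> a < k\<close> by simp
        qed
        then have "?P (\<pi> a) = ?P a" using lookup[OF \<pi>] eq by simp
        then show ?thesis
          using prime_ge_2_nat[OF prime_CARD[where 'p = 'p]] by simp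
      qed (use permutes_not_in[OF \<pi>, of a] in auto)
    qed
    then show "Poly_Mapping.lookup (Poly_Mapping.single (mon \<pi>) (signof \<pi>
        :: 'p mod_ring)) (mon id) =
        (if \<pi> = id then 1 else 0)"
      by (auto simp: lookup_single when_def)
  qed
  also have "\<dots> = 1"
    by (simp add: permutes_id[unfolded id_def] finite_permutations flip: id_def)
  finally show ?thesis by auto
qed

text \<open>
  The coefficient is found by evaluating a second product in two ways. In it, the factors of row
  \<open>i\<close> are the determinants for the bracket in all variables \<open>x\<^sub>1, \<dots>, x\<^sub>i\<^sub>+\<^sub>1\<close>, with \<open>i\<close> counted from
  \<open>0\<close>. By triangularity its coefficient is the unknown one times a product of \<open>w(i)\<close>. On the other
  hand the factors are powers of \<open>T\<close> times \<open>\<Phi>(w(i + 1))\<close>, and the powers of \<open>T\<close> alone exhaust the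
  degree in question, so the coefficient is the product of the \<open>w(i + 1)\<close>. Now \<open>w(i) \<noteq> 0\<close> can be
  cancelled.
\<close>

lemma prod_frob_series_nth:
  assumes "b \<le> CARD('p) - 1"
  shows "(\<Prod>k<n * (CARD('p) - 1) + b. frob_series (Suc (k div (CARD('p) - 1))))
      $ ((b + 1) * CARD('p) ^ n - 1) =
    (w_poly n ^ (CARD('p) - 1 - b) * w_poly (Suc n) ^ b :: 'p::prime_card fp_poly)"
proof -
  let ?p = "CARD('p)" and ?w = "\<lambda>k. vbracket 1 k :: 'p fp_poly"
  define q where "q = ?p - 1"
  define K where "K = n * q + b"
  define M where "M = (b + 1) * ?p ^ n - 1"
  define Z :: "nat \<Rightarrow> 'p fp_poly fps" where "Z = (\<lambda>b. frob_series (1 + b))"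
  define y :: "nat \<Rightarrow> 'p fp_poly fps" where "y = (\<lambda>k. det (series_mat 1 (Suc (k div q))))"
  have p2: "?p \<ge> 2" by (rule prime_ge_2_nat[OF prime_CARD])
  have q0: "q > 0" and bq: "b \<le> q" using p2 assms by (simp_all add: q_def)
  have "\<forall>s. \<exists>c. det (series_mat 1 (Suc s) :: 'p fp_poly fps mat) =
      fps_const (?w s) * Z s + (\<Sum>j<s. fps_const (c j) * Z j)"
    unfolding Z_def by (rule allI, rule det_series_mat_expand, rule exI)
  from choice[OF this] obtain c where c: "\<And>s. det (series_mat 1 (Suc s) :: 'p fp_poly fps mat) =
      fps_const (?w s) * Z s + (\<Sum>j<s. fps_const (c s j) * Z j)"
    by blast
  have y: "y k = fps_const (?w (k div q)) * Z (k div q) +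
      (\<Sum>j\<in>{..<k div q}. fps_const (c (k div q) j) * Z j)" for k
    unfolding y_def by (rule c)
  have Z: "additive_fps ?p (Z b)" for b
    unfolding Z_def by (rule additive_frob_series)
  have "digit_sum ?p M = K"
    using digit_sum_pred_mult_power[OF p2, of b n] assms p2 unfolding M_def K_def q_def by simp
  from prod_nth_eq[OF char_fp_poly[symmetric] prime_CARD Z, folded q_def, OF y _ this]
  have "(\<Prod>k<K. y k) $ M = (\<Prod>k<K. ?w (k div q)) * (\<Prod>k<K. Z (k div q)) $ M"
    by simp
  moreover have "(\<Prod>k<K. y k) $ M = (\<Prod>k<K. ?w (Suc (k div q)))"
  proof -
    have "(\<Prod>k<K. y k) = (\<Prod>k<K. fps_X ^ (?p ^ (k div q)) * hat_total (?w (Suc (k div q))))"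
      unfolding y_def hat_total_vbracket ..
    also have "\<dots> = fps_X ^ (\<Sum>k<K. ?p ^ (k div q)) * hat_total (\<Prod>k<K. ?w (Suc (k div q)))"
      by (simp add: prod.distrib power_sum hat_total.hom_prod)
    also have "(\<Sum>k<K. ?p ^ (k div q)) = M"
      unfolding M_def K_def q_def using p2 assms by (rule sum_power_div)
    finally show ?thesis
      by (simp add: fps_X_power_mult_nth hat_total_const_term)
  qed
  ultimately have eq: "(\<Prod>k<K. ?w (k div q)) * (\<Prod>k<K. Z (k div q)) $ M = (\<Prod>k<K. ?w (Suc (k div q)))"
    by simp
  have "?w 0 = 1" by (simp add: vbracket_eq_det vbracket_mat_def det_def)
  then have shift: "(\<Prod>i<n. ?w (Suc i)) = (\<Prod>i<n. ?w i) * ?w n"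
    by (induction n) simp_all
  let ?D = "(\<Prod>i<n. ?w i) ^ q * ?w n ^ b"
  have "?D * (\<Prod>k<K. Z (k div q)) $ M = ((\<Prod>i<n. ?w i) * ?w n) ^ q * ?w (Suc n) ^ b"
    using eq prod_div_blocks[OF q0 bq, of ?w n] prod_div_blocks[OF q0 bq, of "\<lambda>i. ?w (Suc i)" n]
    unfolding K_def shift by simp
  also have "?w n ^ q = ?w n ^ b * ?w n ^ (q - b)"
    using bq by (simp flip: power_add)
  then have "((\<Prod>i<n. ?w i) * ?w n) ^ q * ?w (Suc n) ^ b = ?D * (?w n ^ (q - b) * ?w (Suc n) ^ b)"
    by (simp add: power_mult_distrib mult_ac)
  finally have "?D * (\<Prod>k<K. Z (k div q)) $ M = ?D * (?w n ^ (q - b) * ?w (Suc n) ^ b)" .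
  moreover have "?D \<noteq> 0" using vbracket_1_nonzero[where 'p = 'p] by (simp del: One_nat_def)
  ultimately have "(\<Prod>k<K. Z (k div q)) $ M = ?w n ^ (q - b) * ?w (Suc n) ^ b"
    using mult_left_cancel by blast
  then show ?thesis
    unfolding K_def Z_def M_def q_def w_poly_eq_vbracket by simp
qed

text \<open>
  One operation shortens every bracket by its last variable. The hypothesis \<open>deg\<close> says that the
  operation selects the term of degree \<open>(b + 1) p\<^sup>n - 1\<close> in a product of \<open>n (p - 1) + b\<close> additive
  series. As this number is the digit sum of that degree, only the leading terms of the expansions
  along the last rows contribute; they give the shortened brackets and the product evaluated in
  \<open>prod_frob_series_nth\<close>.
\<close>

lemma P_hat_prod_vbracket:
  fixes s :: "nat \<Rightarrow> nat"
  assumes b: "b \<le> CARD('p::prime_card) - 1" and K: "K = n * (CARD('p) - 1) + b"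
    and s: "\<And>k. k < K \<Longrightarrow> s k \<le> k div (CARD('p) - 1)"
    and deg: "(CARD('p) - 1) * r + (\<Sum>k<K. CARD('p) ^ s k) = (b + 1) * CARD('p) ^ n - 1"
  shows "P_hat r (\<Prod>k<K. vbracket (Suc (k div (CARD('p) - 1)) - s k) (Suc (s k))) =
    (w_poly n ^ (CARD('p) - 1 - b) * w_poly (Suc n) ^ b
      * (\<Prod>k<K. vbracket (Suc (k div (CARD('p) - 1)) - s k) (s k)) :: 'p fp_poly)"
proof -
  let ?p = "CARD('p)"
  define q where "q = ?p - 1"
  define M where "M = (b + 1) * ?p ^ n - 1"
  define t where "t k = Suc (k div q) - s k" for k
  define Z :: "nat \<Rightarrow> 'p fp_poly fps" where "Z = (\<lambda>b. frob_series (Suc b))"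
  define y :: "nat \<Rightarrow> 'p fp_poly fps" where "y = (\<lambda>k. det (series_mat (t k) (Suc (s k))))"
  have p2: "?p \<ge> 2" by (rule prime_ge_2_nat[OF prime_CARD])
  have q0: "q > 0" using p2 by (simp add: q_def)
  have "\<forall>k. \<exists>c. y k = fps_const (vbracket (t k) (s k)) * frob_series (t k + s k) +
      (\<Sum>j<s k. fps_const (c j) * frob_series (t k + j))"
    unfolding y_def by (rule allI, rule det_series_mat_expand, rule exI)
  from choice[OF this] obtain c where c: "\<And>k. y k = fps_const (vbracket (t k) (s k))
      * frob_series (t k + s k) +
      (\<Sum>j<s k. fps_const (c k j) * frob_series (t k + j))"
    by blast
  have Z: "frob_series (t k + j) = Z (k div q - s k + j)" if "k < K" for k j
    using s[OF that] by (simp add: Z_def t_def q_def Suc_diff_le)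
  have y: "y k = fps_const (vbracket (t k) (s k)) * Z (k div q) +
      (\<Sum>j\<in>{..<s k}. fps_const (c k j) * Z (k div q - s k + j))" if "k < K" for k
    using c[of k] Z[OF that] s[OF that] by (simp add: q_def)
  have row: "k div q - s k + j < k div q" if "k < K" "j \<in> {..<s k}" for k j
    using that s[of k] unfolding q_def by simp
  have add: "additive_fps ?p (Z b)" for b
    unfolding Z_def by (rule additive_frob_series)
  have "digit_sum ?p M = K"
    using digit_sum_pred_mult_power[OF p2, of b n] b p2 unfolding M_def K by simp
  from prod_nth_eq[OF char_fp_poly[symmetric] prime_CARD add, folded q_def, OF y row this]
  have "(\<Prod>k<K. y k) $ M = (\<Prod>k<K. vbracket (t k) (s k)) * (\<Prod>k<K. Z (k div q)) $ M" .
  also have "(\<Prod>k<K. Z (k div q)) $ M = w_poly n ^ (q - b) * w_poly (Suc n) ^ b"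
    unfolding K Z_def M_def q_def using b by (rule prod_frob_series_nth)
  finally have "(\<Prod>k<K. y k) $ M = w_poly n ^ (q - b) * w_poly (Suc n) ^ b *
      (\<Prod>k<K. vbracket (t k) (s k))"
    by (simp add: mult.commute)
  moreover have "(\<Prod>k<K. y k) = fps_X ^ (\<Sum>k<K. ?p ^ s k) * hat_total
      (\<Prod>k<K. vbracket (t k) (Suc (s k)))"
    unfolding y_def by (simp add: prod.distrib power_sum hat_total.hom_prod flip:
        hat_total_vbracket)
  moreover have "M = q * r + (\<Sum>k<K. ?p ^ s k)" unfolding M_def q_def deg ..
  moreover have "hat_total f $ (q * r) = P_hat r f" for f :: "'p fp_poly"
    using hat_total_nth[of f "q * r", folded q_def] q0 by simp
  ultimately have "P_hat r (\<Prod>k<K. vbracket (t k) (Suc (s k))) =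
      (w_poly n ^ (q - b) * w_poly (Suc n) ^ b * (\<Prod>k<K. vbracket (t k) (s k)) :: 'p fp_poly)"
    by (simp add: fps_X_power_mult_nth)
  then show ?thesis unfolding t_def q_def .
qed

section \<open>Inert polynomials\<close>

text \<open>
  A polynomial that all operations of positive index below a bound annihilate can be moved out of
  the operations below that bound, by the Cartan formula. This carries the factors \<open>w(k)\<close> produced
  by one operation through the later ones.
\<close>

definition inert :: "nat \<Rightarrow> 'p::prime_card fp_poly \<Rightarrow> bool" where
  "inert B F \<longleftrightarrow> (\<forall>r. 0 < r \<and> r < B \<longrightarrow> P_hat r F = 0)"

lemma inert_P_hat_mult:
  assumes "inert B F" "r < B"
  shows "P_hat r (F * h) = F * P_hat r (h :: 'p::prime_card fp_poly)"
proof -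
  let ?q = "CARD('p) - 1"
  have q0: "?q > 0" using prime_ge_2_nat[OF prime_CARD[where 'p = 'p]] by simp
  have "P_hat r (F * h) = hat_total (F * h) $ (?q * r)"
    using q0 by (simp add: hat_total_nth)
  also have "\<dots> = (\<Sum>i = 0..?q * r. hat_total F $ i * hat_total h $ (?q * r - i))"
    by (simp add: hat_total.hom_mult fps_mult_nth)
  also have "\<dots> = (\<Sum>i\<in>{0}. hat_total F $ i * hat_total h $ (?q * r - i))"
  proof (rule sum.mono_neutral_right)
    show "\<forall>i\<in>{0..?q * r} - {0}. hat_total F $ i * hat_total h $ (?q * r - i) = 0"
    proof
      fix i assume i: "i \<in> {0..?q * r} - {0}"
      have "hat_total F $ i = 0"
      proof (cases "?q dvd i")
        case True
        then obtain r' where r': "i = ?q * r'" by blast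
        then have "0 < r'" "r' \<le> r" using i q0 by auto
        then have "P_hat r' F = 0" using assms unfolding inert_def by simp
        then show ?thesis using r' q0 by (simp add: hat_total_nth)
      qed (simp add: hat_total_nth)
      then show "hat_total F $ i * hat_total h $ (?q * r - i) = 0" by simp
    qed
  qed auto
  also have "\<dots> = F * P_hat r h"
    using q0 by (simp add: hat_total_const_term) (simp add: hat_total_nth)
  finally show ?thesis .
qed

lemma inert_mult: "inert B F \<Longrightarrow> inert B G \<Longrightarrow> inert B (F * G)"
  using inert_P_hat_mult[of B F] unfolding inert_def by simp

lemma inert_mono: "inert B F \<Longrightarrow> C \<le> B \<Longrightarrow> inert C F"
  unfolding inert_def by simp

lemma inert_1: "inert B (1 :: 'p::prime_card fp_poly)"
  unfolding inert_def
proof (intro allI impI)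
  fix r assume "0 < r \<and> r < B"
  moreover have "CARD('p) - 1 > 0"
    using prime_ge_2_nat[OF prime_CARD[where 'p = 'p]] by simp
  ultimately show "P_hat r (1 :: 'p fp_poly) = 0"
    using hat_total_nth[of "1 :: 'p fp_poly" "(CARD('p) - 1) * r"] by (simp add: hat_total.hom_one)
qed

lemma inert_power: "inert B F \<Longrightarrow> inert B (F ^ k)"
  by (induction k) (simp_all add: inert_1 inert_mult)

text \<open>
  The terms of \<open>T\<^sup>q \<Phi>(w(k + 1))\<close>, where \<open>q = p\<^sup>k\<close>, lie at powers of \<open>p\<close>. The term at \<open>q\<close> itself
  belongs to the identity operation, and the next possible term, at \<open>p q\<close>, belongs to the
  operation of index \<open>q\<close>.
\<close>

lemma inert_w_poly: "inert (CARD('p) ^ k) (w_poly (Suc k) :: 'p::prime_card fp_poly)"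
  unfolding inert_def
proof (intro allI impI, elim conjE, rule ccontr)
  fix r assume r: "0 < r" "r < CARD('p) ^ k" and nz: "P_hat r (w_poly (Suc k) :: 'p fp_poly) \<noteq> 0"
  let ?p = "CARD('p)"
  have p2: "?p \<ge> 2" by (rule prime_ge_2_nat[OF prime_CARD])
  have "det (series_mat 1 (Suc k)) $ (?p ^ k + (?p - 1) * r) = P_hat r (w_poly (Suc k)
      :: 'p fp_poly)"
    using p2 by (simp add: fps_X_power_mult_nth hat_total_nth w_poly_eq_vbracket flip:
        hat_total_vbracket)
  then obtain j where j: "?p ^ k + (?p - 1) * r = ?p ^ j"
    using additive_det_series_mat[of 1 k, where 'p = 'p] nz unfolding additive_fps_def by metis
  have "?p ^ k < ?p ^ j" using j r p2 by (metis less_add_same_cancel1 nat_0_less_mult_iff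
      zero_less_diff less_le_trans one_less_numeral_iff semiring_norm(76))
  then have "k < j" using p2 by (simp add: power_strict_increasing_iff)
  then have "?p ^ Suc k \<le> ?p ^ j" using p2 by (intro power_increasing) auto
  moreover have "(?p - 1) * r < (?p - 1) * ?p ^ k" using r p2 by simp
  then have "?p ^ k + (?p - 1) * r < ?p ^ k + (?p - 1) * ?p ^ k" by simp
  moreover have "?p ^ k + (?p - 1) * ?p ^ k = ?p ^ Suc k"
    using p2 by (metis add_mult_distrib mult_1 power_Suc le_add_diff_inverse one_le_numeral
        order_trans)
  ultimately show False using j by linarith
qed

section \<open>Induction over the blocks of columns\<close>

text \<open>
  A \<open>T\<close>-regular partition is determined by its \<open>T\<close>-conjugate, and the proof works with the list
  \<open>gs = (\<gamma>\<^sub>1, \<gamma>\<^sub>2, \<dots>)\<close> instead of the diagram; removing the first block of \<open>q = p - 1\<close> columns is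
  passing to the tail. \<open>strip_height q gs k\<close> is the number of boxes of antidiagonal \<open>k + 1\<close>. Its
  lowest box lies in the first block, and the other boxes form the antidiagonal with number
  smaller by \<open>q\<close> of the remaining diagram.
\<close>

fun strip_height :: "nat \<Rightarrow> nat list \<Rightarrow> nat \<Rightarrow> nat" where
  "strip_height q [] k = 0"
| "strip_height q (g # gs) k =
     (if k < g then Suc (if q \<le> k then strip_height q gs (k - q) else 0) else 0)"

abbreviation tail_height :: "nat \<Rightarrow> nat list \<Rightarrow> nat \<Rightarrow> nat" where
  "tail_height q gs k \<equiv> (if q \<le> k then strip_height q gs (k - q) else 0)"

text \<open>
  The property of \<open>T\<close>-conjugates that the induction uses: they fall by at least \<open>q = p - 1\<close> in
  each step, and the last one is positive.
\<close>

fun steep :: "nat \<Rightarrow> nat list \<Rightarrow> bool" where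
  "steep q [] \<longleftrightarrow> True"
| "steep q [g] \<longleftrightarrow> g > 0"
| "steep q (g # h # gs) \<longleftrightarrow> h + q \<le> g \<and> steep q (h # gs)"

fun radix_sum :: "nat \<Rightarrow> nat list \<Rightarrow> nat" where
  "radix_sum p [] = 0"
| "radix_sum p (g # gs) = g + p * radix_sum p gs"

text \<open>
  \<open>v(\<lambda>)\<close> in terms of the \<open>T\<close>-conjugate. The lowest box of antidiagonal \<open>k + 1\<close> is in row
  \<open>k div q + 1\<close>.
\<close>

definition v_strips :: "nat list \<Rightarrow> 'p::prime_card fp_poly" where
  "v_strips gs = (let q = CARD('p) - 1 in
     \<Prod>k<(case gs of [] \<Rightarrow> 0 | g # _ \<Rightarrow> g).
       vbracket (k div q + 2 - strip_height q gs k) (strip_height q gs k))"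

text \<open>
  The product of the \<open>w(\<lambda>'\<^sub>j)\<close> over a block of \<open>q = p - 1\<close> columns with \<open>g = n q + b\<close> boxes, where
  \<open>1 \<le> b \<le> q\<close>: of these columns, \<open>b\<close> have \<open>n + 1\<close> boxes and the other ones have \<open>n\<close>. The division
  of \<open>g - 1\<close> instead of \<open>g\<close> gives the remainder in the required range.
\<close>

definition w_block :: "nat \<Rightarrow> 'p::prime_card fp_poly" where
  "w_block g = (let q = CARD('p) - 1; n = (g - 1) div q; b = (g - 1) mod q + 1 in
     w_poly n ^ (q - b) * w_poly (Suc n) ^ b)"

text \<open>
  The exponent \<open>(b + 1) p\<^sub>n - n - \<Sum> p\<^sup>j\<^sup>-\<^sup>2 \<gamma>\<^sub>j\<close> of the first operation, where \<open>p\<^sub>n\<close> is \<open>p_num p n\<close> and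
  the first block has \<open>\<gamma>\<^sub>1 = n (p - 1) + b\<close> boxes. The subtractions do not truncate, by
  \<open>radix_sum_le\<close>.
\<close>

definition hat_exponent :: "nat \<Rightarrow> nat list \<Rightarrow> nat" where
  "hat_exponent p gs = (case gs of [] \<Rightarrow> 0 | g # hs \<Rightarrow>
     ((g - 1) mod (p - 1) + 2) * p_num p ((g - 1) div (p - 1)) - (g - 1) div (p - 1)
         - radix_sum p hs)"

text \<open>
  A strict upper bound for the exponent of the operation belonging to the block, monotone in its
  size.
\<close>

definition inert_bound :: "nat \<Rightarrow> nat \<Rightarrow> nat" where
  "inert_bound p g = ((g - 1) mod (p - 1) + 2) * p_num p ((g - 1) div (p - 1)) + 1"

fun apply_hats :: "nat list \<Rightarrow> 'p::prime_card fp_poly \<Rightarrow> 'p fp_poly" where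
  "apply_hats [] f = f"
| "apply_hats (g # gs) f = apply_hats gs (P_hat (hat_exponent CARD('p) (g # gs)) f)"

lemma strip_height_le:
  assumes "q > 0"
  shows "strip_height q gs k \<le> Suc (k div q)"
proof (induction gs arbitrary: k)
  case (Cons g gs)
  have "strip_height q gs (k - q) \<le> k div q" if "q \<le> k"
    using Cons[of "k - q"] that assms by (simp add: le_div_geq)
  then show ?case by simp
qed simp

lemma tail_height_le:
  assumes "q > 0"
  shows "tail_height q gs k \<le> k div q"
  using strip_height_le[OF assms, of gs "k - q"] assms by (simp add: le_div_geq)

lemma sum_lessThan_add:
  fixes f :: "nat \<Rightarrow> 'a::comm_monoid_add"
  shows "(\<Sum>k<a + b. f k) = (\<Sum>k<a. f k) + (\<Sum>k<b. f (a + k))"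
  by (induction b) (simp_all add: add.assoc)

lemma prod_lessThan_add:
  fixes f :: "nat \<Rightarrow> 'a::comm_monoid_mult"
  shows "(\<Prod>k<a + b. f k) = (\<Prod>k<a. f k) * (\<Prod>k<b. f (a + k))"
  by (induction b) (simp_all add: mult.assoc)

text \<open>
  The left-hand side is the exponent of the power of \<open>T\<close> by which \<open>hat_total_vbracket\<close> multiplies
  the image of \<open>v(\<lambda>)\<close>.
\<close>

lemma sum_power_tail_height:
  assumes p: "p \<ge> 1" and steep: "steep (p - 1) (g # gs)"
  shows "(\<Sum>k<g. p ^ tail_height (p - 1) gs k) = g + (p - 1) * radix_sum p gs"
  using steep
proof (induction gs arbitrary: g)
  case (Cons h hs)
  define q where "q = p - 1"
  define e where "e = g - (h + q)"
  have g: "g = q + (h + e)" and steep: "steep q (h # hs)"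
    using Cons.prems by (simp_all add: q_def e_def)
  have IH: "(\<Sum>k<h. p ^ tail_height q hs k) = h + q * radix_sum p hs"
    using Cons.IH[of h] steep unfolding q_def by simp
  have "(\<Sum>k<g. p ^ tail_height q (h # hs) k) = q + (\<Sum>k<h. p * p ^ tail_height q hs k) + e"
    unfolding g sum_lessThan_add by simp
  also have "\<dots> = q + p * (h + q * radix_sum p hs) + e"
    by (simp only: IH flip: sum_distrib_left)
  also have "\<dots> = g + q * radix_sum p (h # hs)"
  proof -
    have "p = Suc q" using p by (simp add: q_def)
    then show ?thesis by (simp add: g algebra_simps)
  qed
  finally show ?case unfolding q_def .
qed (simp cong: if_cong)

lemma vbracket_0 [simp]: "vbracket t 0 = 1"
  by (simp add: vbracket_eq_det vbracket_mat_def det_def)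

text \<open>
  Removing the lowest box of every antidiagonal removes the first block of columns.
\<close>

lemma v_strips_tail:
  assumes "steep (CARD('p::prime_card) - 1) (g # gs)"
  shows "(v_strips gs :: 'p fp_poly) =
    (\<Prod>k<g. vbracket (Suc (k div (CARD('p) - 1)) - tail_height (CARD('p) - 1) gs k)
              (tail_height (CARD('p) - 1) gs k))"
proof (cases gs)
  case Nil
  then show ?thesis by (simp add: v_strips_def cong: if_cong)
next
  case (Cons h hs)
  define q where "q = CARD('p) - 1"
  have q0: "q > 0" using prime_ge_2_nat[OF prime_CARD[where 'p = 'p]] by (simp add: q_def)
  define e where "e = g - (h + q)"
  have g: "g = q + (h + e)" using assms by (simp add: q_def e_def Cons)
  have "(\<Prod>k<g. vbracket (Suc (k div q) - tail_height q gs k) (tail_height q gs k) :: 'p fp_poly) =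
      (\<Prod>k<h. vbracket (k div q + 2 - strip_height q gs k) (strip_height q gs k))"
    unfolding g prod_lessThan_add using q0 by (simp add: Cons div_add_self1)
  then show ?thesis
    unfolding v_strips_def Let_def q_def[symmetric] by (simp only: Cons list.case)
qed

lemma v_strips_head:
  "(v_strips (g # gs) :: 'p::prime_card fp_poly) =
    (\<Prod>k<g. vbracket (Suc (k div (CARD('p) - 1)) - tail_height (CARD('p) - 1) gs k)
              (Suc (tail_height (CARD('p) - 1) gs k)))"
  unfolding v_strips_def Let_def by (auto intro!: prod.cong)

lemma pred_mult_p_num:
  assumes "p \<ge> 2"
  shows "(p - 1) * p_num p k = p ^ k - 1"
proof -
  have "p - 1 dvd p ^ k - 1"
  proof (induction k)
    case (Suc k)
    have "p ^ k \<ge> 1" using assms by simp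
    then have "p ^ Suc k - 1 = (p - 1) * p ^ k + (p ^ k - 1)"
      using assms by (simp add: diff_mult_distrib)
    then show ?case using Suc by (metis dvd_add dvd_triv_left)
  qed simp
  then show ?thesis unfolding p_num_def by simp
qed

lemma div_mod_pred:
  fixes b q n :: nat
  assumes "1 \<le> b" "b \<le> q"
  shows "(n * q + b - 1) div q = n" "(n * q + b - 1) mod q = b - 1"
proof -
  have "n * q + b - 1 = n * q + (b - 1)" and "b - 1 < q" using assms by auto
  then show "(n * q + b - 1) div q = n" "(n * q + b - 1) mod q = b - 1" by simp_all
qed

lemma block_size_cases:
  fixes q g :: nat
  assumes "q > 0" "g > 0"
  obtains n b where "g = n * q + b" "1 \<le> b" "b \<le> q"
proof (rule that[of "(g - 1) div q" "(g - 1) mod q + 1"])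
  show "g = (g - 1) div q * q + ((g - 1) mod q + 1)" using assms by simp
  show "(g - 1) mod q + 1 \<le> q" using assms by (simp add: Suc_le_eq)
qed simp

lemma steep_head_pos: "steep q (g # gs) \<Longrightarrow> q > 0 \<Longrightarrow> g > 0"
  by (cases gs) auto

lemma steep_tl: "steep q (g # gs) \<Longrightarrow> steep q gs"
  by (cases gs) auto

text \<open>
  In row \<open>i\<close> of the diagram an antidiagonal has at most \<open>i - 1\<close> boxes above its lowest one. If all
  had so many, then \<open>sum_power_div\<close> would give the sum of the corresponding powers of \<open>p\<close>;
  comparing this with \<open>sum_power_tail_height\<close> bounds the sum that is subtracted in the exponent.
\<close>

lemma radix_sum_le:
  assumes p2: "p \<ge> 2" and b: "1 \<le> b" "b \<le> p - 1" and steep: "steep (p - 1) ((n * (p - 1) + b) # gs)"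
  shows "n + radix_sum p gs \<le> (b + 1) * p_num p n"
proof -
  define q where "q = p - 1"
  have q: "p = Suc q" "q > 0" using p2 by (simp_all add: q_def)
  define K where "K = n * (p - 1) + b"
  have "K + q * radix_sum p gs = (\<Sum>k<K. p ^ tail_height q gs k)"
    using sum_power_tail_height[of p K gs, folded q_def] steep p2 by (simp add: K_def q_def)
  also have "\<dots> \<le> (\<Sum>k<K. p ^ (k div (p - 1)))"
    unfolding q_def[symmetric] using tail_height_le[OF q(2)] p2
    by (intro sum_mono power_increasing) auto
  also have "\<dots> = (b + 1) * p ^ n - 1"
    unfolding K_def by (rule sum_power_div[OF p2 b(2)])
  finally have "K + q * radix_sum p gs + 1 \<le> (b + 1) * p ^ n"
    using p2 by (simp add: Suc_le_eq) (metis Suc_pred add_gr_0 le_imp_less_Suc zero_less_power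
        less_le_trans zero_less_numeral)
  also have "p ^ n = q * p_num p n + 1"
    using pred_mult_p_num[OF p2, of n] p2 q by simp
  finally have "q * (n + radix_sum p gs) \<le> q * ((b + 1) * p_num p n)"
    by (simp add: K_def q algebra_simps)
  then show ?thesis using q(2) by simp
qed

lemma P_hat_v_strips:
  assumes "steep (CARD('p::prime_card) - 1) (g # gs)"
  shows "P_hat (hat_exponent CARD('p) (g # gs)) (v_strips (g # gs)) = w_block g * (v_strips gs
      :: 'p fp_poly)"
proof -
  let ?p = "CARD('p)"
  define q where "q = ?p - 1"
  have p2: "?p \<ge> 2" by (rule prime_ge_2_nat[OF prime_CARD])
  then have q0: "q > 0" by (simp add: q_def)
  have steep: "steep q (g # gs)" using assms by (simp add: q_def)
  obtain n b where g: "g = n * q + b" and b: "1 \<le> b" "b \<le> q"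
    using block_size_cases[OF q0 steep_head_pos[OF steep q0]] .
  define r where "r = hat_exponent ?p (g # gs)"
  have r: "r = (b + 1) * p_num ?p n - n - radix_sum ?p gs"
    using b div_mod_pred[OF b, of n] unfolding r_def hat_exponent_def g q_def by simp
  have le: "n + radix_sum ?p gs \<le> (b + 1) * p_num ?p n"
    using radix_sum_le[OF p2, of b n gs] b steep by (simp add: g q_def)
  then have "r + (n + radix_sum ?p gs) = (b + 1) * p_num ?p n"
    unfolding r by simp
  then have "q * (r + (n + radix_sum ?p gs)) = (b + 1) * (q * p_num ?p n)"
    by (simp only: mult.left_commute)
  moreover have "?p ^ n = q * p_num ?p n + 1"
    using pred_mult_p_num[OF p2, of n, folded q_def] p2 by simp
  ultimately have "q * r + (g + q * radix_sum ?p gs) + 1 = (b + 1) * ?p ^ n"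
    by (simp add: g algebra_simps)
  then have "q * r + (g + q * radix_sum ?p gs) = (b + 1) * ?p ^ n - 1"
    by (metis add_diff_cancel_right')
  then have deg: "q * r + (\<Sum>k<g. ?p ^ tail_height q gs k) = (b + 1) * ?p ^ n - 1"
    using sum_power_tail_height[of ?p g gs, folded q_def, OF _ steep] p2 by simp
  have "P_hat r (\<Prod>k<g. vbracket (Suc (k div q) - tail_height q gs k) (Suc (tail_height q gs k))) =
      (w_poly n ^ (q - b) * w_poly (Suc n) ^ b *
       (\<Prod>k<g. vbracket (Suc (k div q) - tail_height q gs k) (tail_height q gs k)) :: 'p fp_poly)"
    by (rule P_hat_prod_vbracket[where 'p = 'p and s = "\<lambda>k. tail_height q gs k", folded q_def,
          OF b(2) g tail_height_le[OF q0] deg])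
  moreover have "w_block g = (w_poly n ^ (q - b) * w_poly (Suc n) ^ b :: 'p fp_poly)"
    using b div_mod_pred[OF b, of n] unfolding w_block_def Let_def g q_def[symmetric] by simp
  ultimately show ?thesis
    unfolding v_strips_head v_strips_tail[OF assms] r_def q_def by simp
qed

text \<open>
  Write \<open>h = m (p - 1) + c\<close> and \<open>g = n (p - 1) + b\<close> with \<open>1 \<le> b, c \<le> p - 1\<close>, so that \<open>m + 1 \<le> n\<close>.
  The factors of \<open>w_block g\<close> are \<open>w(n + 1)\<close> and, unless \<open>b = p - 1\<close>, \<open>w(n)\<close>. The latter is inert
  up to \<open>p\<^sup>n\<^sup>-\<^sup>1\<close> only. This suffices for \<open>c < p - 1\<close>, and for \<open>c = p - 1\<close> the condition \<open>b < p - 1\<close>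
  forces \<open>m + 2 \<le> n\<close>.
\<close>

lemma inert_w_block:
  assumes h: "h > 0" and hg: "h + (CARD('p::prime_card) - 1) \<le> g"
  shows "inert (inert_bound CARD('p) h) (w_block g :: 'p fp_poly)"
    and "inert_bound CARD('p) h \<le> inert_bound CARD('p) g"
proof -
  let ?p = "CARD('p)"
  have p2: "?p \<ge> 2" by (rule prime_ge_2_nat[OF prime_CARD])
  then obtain q where q: "?p = Suc q" "q > 0" by (cases ?p) auto
  obtain n b where g: "g = n * q + b" and b: "1 \<le> b" "b \<le> q"
    using block_size_cases[OF q(2), of g] h hg by auto
  obtain m c where h': "h = m * q + c" and c: "1 \<le> c" "c \<le> q"
    using block_size_cases[OF q(2) h] .
  have bound: "inert_bound ?p (k * q + a) = (a + 1) * p_num ?p k + 1" if "1 \<le> a" "a \<le> q" for k a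
    using that div_mod_pred[OF that, of k] by (simp add: inert_bound_def q)
  have p_num: "q * p_num ?p k + 1 = ?p ^ k" for k
    using pred_mult_p_num[OF p2, of k] p2 q by simp
  have *: "Suc m * q + c \<le> n * q + b" using hg by (simp add: g h' q)
  have "Suc m \<le> n"
  proof (rule ccontr)
    assume "\<not> Suc m \<le> n"
    then have "n * q \<le> m * q" by (intro mult_le_mono1) simp
    then show False using * b c unfolding mult_Suc by linarith
  qed
  have "(c + 1) * p_num ?p m \<le> ?p * p_num ?p m" using c q by (intro mult_le_mono1) simp
  also have "\<dots> < p_num ?p (Suc m)"
  proof -
    have "q * p_num ?p (Suc m) + 1 = ?p * (q * p_num ?p m + 1)"
      unfolding p_num by simp
    also have "\<dots> = q * (?p * p_num ?p m) + ?p" by (simp only: distrib_left mult_1_right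
        mult.left_commute)
    finally have "q * (?p * p_num ?p m) < q * p_num ?p (Suc m)" using q by linarith
    then show ?thesis by simp
  qed
  also have "\<dots> \<le> p_num ?p n"
    unfolding p_num_def using \<open>Suc m \<le> n\<close> p2
    by (intro div_le_mono diff_le_mono power_increasing) auto
  finally have le: "(c + 1) * p_num ?p m < p_num ?p n" .
  then show "inert_bound ?p h \<le> inert_bound ?p g"
    unfolding g h' bound[OF b] bound[OF c] by (simp add: algebra_simps)
  have 1: "inert_bound ?p h \<le> ?p ^ n"
    using le p_num[of n] q unfolding h' bound[OF c]
        by (metis Suc_eq_plus1 Suc_leI le_add1 le_trans less_imp_le mult_le_mono1 One_nat_def
            mult_1)
  have 2: "inert (inert_bound ?p h) (w_poly n ^ (q - b) :: 'p fp_poly)"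
  proof (cases "b = q")
    case True
    then show ?thesis by (simp add: inert_1)
  next
    case False
    obtain n' where n': "n = Suc n'" using \<open>Suc m \<le> n\<close> by (cases n) auto
    have "(c + 1) * p_num ?p m < ?p ^ n'"
    proof (cases "c = q")
      case True
      have "Suc (Suc m) \<le> n"
      proof (rule ccontr)
        assume "\<not> Suc (Suc m) \<le> n"
        then have "n * q \<le> Suc m * q" by (intro mult_le_mono1) simp
        then show False using * b True \<open>b \<noteq> q\<close> by linarith
      qed
      then have le: "?p ^ Suc m \<le> ?p ^ n'" using p2 n' by (intro power_increasing) auto
      have "q * p_num ?p m < ?p ^ m" using p_num[of m] by simp
      then have "p_num ?p m < ?p ^ m" using q(2)
        by (metis le_less_trans mult_le_mono1 mult_1 Suc_leI One_nat_def)
      then have "?p * p_num ?p m < ?p * ?p ^ m" using p2 by simp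
      moreover have "c + 1 = ?p" using True q by simp
      ultimately have "(c + 1) * p_num ?p m < ?p ^ Suc m" by simp
      then show ?thesis using le by simp
    next
      case False
      then have "(c + 1) * p_num ?p m \<le> q * p_num ?p m" using c by (intro mult_le_mono1) simp
      also have "\<dots> < ?p ^ m" using p_num[of m] by simp
      also have "\<dots> \<le> ?p ^ n'" using p2 n' \<open>Suc m \<le> n\<close> by (intro power_increasing) auto
      finally show ?thesis .
    qed
    then have "inert (inert_bound ?p h) (w_poly n :: 'p fp_poly)"
      using inert_w_poly[of n', where 'p = 'p] unfolding h' bound[OF c] n'
      by (auto intro: inert_mono)
    then show ?thesis by (rule inert_power)
  qed
  have 3: "inert (inert_bound ?p h) (w_poly (Suc n) ^ b :: 'p fp_poly)"
    using inert_w_poly[of n, where 'p = 'p] 1 by (intro inert_power) (rule inert_mono)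
  have "w_block g = (w_poly n ^ (q - b) * w_poly (Suc n) ^ b :: 'p fp_poly)"
    using b div_mod_pred[OF b, of n] unfolding w_block_def Let_def g by (simp add: q)
  then show "inert (inert_bound ?p h) (w_block g :: 'p fp_poly)"
    using 2 3 by (simp add: inert_mult)
qed

text \<open>
  The factor \<open>F\<close> collects the polynomials \<open>w(k)\<close> that have already been produced. It stays inert
  for all operations to come, because the bounds for their exponents decrease along with the
  blocks.
\<close>

lemma apply_hats_inert_mult_v_strips:
  assumes "steep (CARD('p::prime_card) - 1) gs" "gs \<noteq> []" "inert (inert_bound CARD('p) (hd gs)) F"
  shows "apply_hats gs (F * v_strips gs) = F * (\<Prod>g\<leftarrow>gs. w_block g :: 'p fp_poly)"
  using assms
proof (induction gs arbitrary: F)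
  case (Cons g gs)
  have q0: "CARD('p) - 1 > 0" using prime_ge_2_nat[OF prime_CARD[where 'p = 'p]] by simp
  have "hat_exponent CARD('p) (g # gs) < inert_bound CARD('p) g"
    unfolding hat_exponent_def inert_bound_def by (simp add: less_Suc_eq_le)
  then have step: "P_hat (hat_exponent CARD('p) (g # gs)) (F * v_strips (g # gs)) =
      F * w_block g * v_strips gs"
    using Cons.prems inert_P_hat_mult[of _ F] by (simp add: P_hat_v_strips mult.assoc)
  show ?case
  proof (cases gs)
    case Nil
    then show ?thesis using step by (simp add: v_strips_def)
  next
    case (Cons h hs)
    have steep: "steep (CARD('p) - 1) gs" and hg: "h + (CARD('p) - 1) \<le> g"
      using Cons.prems(1) \<open>gs = h # hs\<close> by simp_all
    then have "h > 0" using steep_head_pos q0 \<open>gs = h # hs\<close> by blast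
    have "inert (inert_bound CARD('p) h) (F * w_block g)"
      using Cons.prems(3) inert_w_block[OF \<open>h > 0\<close> hg]
      by (intro inert_mult) (auto intro: inert_mono)
    then show ?thesis
      using Cons.IH[of "F * w_block g"] steep step \<open>gs = h # hs\<close> by (simp add: mult.assoc)
  qed
qed simp

lemma apply_hats_v_strips:
  assumes "steep (CARD('p::prime_card) - 1) gs"
  shows "apply_hats gs (v_strips gs) = (\<Prod>g\<leftarrow>gs. w_block g :: 'p fp_poly)"
proof (cases "gs = []")
  case True
  then show ?thesis by (simp add: v_strips_def)
next
  case False
  then show ?thesis using apply_hats_inert_mult_v_strips[OF assms False inert_1] by simp
qed

section \<open>The diagram of a T-regular partition\<close>

text \<open>
  The values are \<open>q, \<dots>, q\<close>, then at most one value strictly between \<open>0\<close> and \<open>q\<close>, then \<open>0, 0, \<dots>\<close>,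
  so the sum determines every one of them.
\<close>

lemma staircase_sum_iff:
  fixes \<beta> :: "nat \<Rightarrow> nat"
  assumes le: "\<And>i. \<beta> i \<le> q" and anti: "\<And>i j. i \<le> j \<Longrightarrow> \<beta> j \<le> \<beta> i"
    and unique: "\<And>i j. 0 < \<beta> i \<Longrightarrow> \<beta> i < q \<Longrightarrow> 0 < \<beta> j \<Longrightarrow> \<beta> j < q \<Longrightarrow> i = j"
    and zero: "\<And>i. n \<le> i \<Longrightarrow> \<beta> i = 0"
    and c: "c < q"
  shows "c < \<beta> i \<longleftrightarrow> i * q + c < (\<Sum>j<n. \<beta> j)"
proof
  assume i: "c < \<beta> i"
  then have "i < n" using zero[of i] by (metis not_less_zero not_le)
  have "\<beta> j = q" if "j < i" for j
    using anti[of j i] unique[of j i] le[of j] le[of i] i that by (metis le_less_trans less_imp_le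
        less_irrefl not_gr_zero not_less0 order_le_less)
  then have "i * q + \<beta> i = (\<Sum>j<Suc i. \<beta> j)" by simp
  also have "\<dots> \<le> (\<Sum>j<n. \<beta> j)" using \<open>i < n\<close> by (intro sum_mono2) auto
  finally show "i * q + c < (\<Sum>j<n. \<beta> j)" using i by simp
next
  assume *: "i * q + c < (\<Sum>j<n. \<beta> j)"
  show "c < \<beta> i"
  proof (rule ccontr)
    assume "\<not> c < \<beta> i"
    then have "\<beta> i < q" and ic: "\<beta> i \<le> c" using c by simp_all
    have "\<beta> j = 0" if "i < j" for j
      using anti[of i j] unique[of i j] \<open>\<beta> i < q\<close> that
      by (metis le_less_trans less_imp_le less_irrefl not_gr_zero order_less_le_trans)
    then have "(\<Sum>j<n. \<beta> j) = (\<Sum>j\<in>{..<n} \<inter> {..i}. \<beta> j)"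
      by (intro sum.mono_neutral_right) (auto, metis less_irrefl not_le_imp_less)
    also have "\<dots> \<le> (\<Sum>j<Suc i. \<beta> j)"
      by (intro sum_mono2) auto
    also have "\<dots> \<le> i * q + \<beta> i"
      using sum_bounded_above[of "{..<i}" \<beta> q] le by simp
    finally show False using * ic by simp
  qed
qed

lemma part_Suc_le:
  assumes "column_regular p L" "1 \<le> i"
  shows "part L (Suc i) \<le> part L i" "part L i \<le> part L (Suc i) + (p - 1)"
proof -
  have "part L (Suc i) \<le> part L i \<and> part L i \<le> part L (Suc i) + (p - 1)"
  proof (cases "i \<le> length L")
    case True
    then have "part L (i + 1) \<le> part L i \<and> part L i - part L (i + 1) \<le> p - 1"
      using assms unfolding column_regular_def by simp
    then show ?thesis by (auto simp: le_diff_conv add.commute)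
  next
    case False
    then show ?thesis by (simp add: part_def)
  qed
  then show "part L (Suc i) \<le> part L i" "part L i \<le> part L (Suc i) + (p - 1)" by simp_all
qed

lemma part_antimono:
  assumes "column_regular p L" "1 \<le> i" "i \<le> j"
  shows "part L j \<le> part L i"
  using assms(3)
proof (induction j rule: dec_induct)
  case (step j)
  then show ?case using part_Suc_le(1)[OF assms(1), of j] assms(2) by simp
qed simp

lemma T_conjugate_eq_sum:
  "T_conjugate p L (Suc a) = (\<Sum>i<length L. min (p - 1) (part L (Suc i) - a * (p - 1)))"
proof -
  let ?q = "p - 1"
  have "{(i, j) \<in> diagram L. (Suc a - 1) * ?q < j \<and> j \<le> Suc a * ?q} =
      (SIGMA i:{1..length L}. {a * ?q<..min (Suc a * ?q) (part L i)})"
    unfolding diagram_def by auto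
  then have "T_conjugate p L (Suc a) = (\<Sum>i\<in>{1..length L}. min (Suc a * ?q) (part L i) - a * ?q)"
    unfolding T_conjugate_def by (simp only:) (subst card_SigmaI, simp_all)
  also have "\<dots> = (\<Sum>i\<in>{1..length L}. min ?q (part L i - a * ?q))"
    by (rule sum.cong) (auto simp: min_def)
  also have "\<dots> = (\<Sum>i<length L. min ?q (part L (Suc i) - a * ?q))"
    by (rule sum.reindex_bij_witness[where i = Suc and j = "\<lambda>i. i - 1"]) auto
  finally show ?thesis .
qed

text \<open>
  In a \<open>T\<close>-regular diagram each block is filled row by row. So whether the box in row \<open>i + 1\<close> and
  in column \<open>c + 1\<close> of block \<open>a + 1\<close> belongs to the diagram depends only on the size of that
  block.
\<close>

lemma box_iff:
  assumes T: "T_regular p L" and c: "c < p - 1"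
  shows "a * (p - 1) + c < part L (Suc i) \<longleftrightarrow> i * (p - 1) + c < T_conjugate p L (Suc a)"
proof -
  let ?q = "p - 1"
  define \<beta> where "\<beta> i = min ?q (part L (Suc i) - a * ?q)" for i
  have col: "column_regular p L" using T unfolding T_regular_def by blast
  have "c < \<beta> i \<longleftrightarrow> i * ?q + c < (\<Sum>j<length L. \<beta> j)"
  proof (rule staircase_sum_iff)
    show "\<beta> i \<le> ?q" for i by (simp add: \<beta>_def)
    show "\<beta> j \<le> \<beta> i" if "i \<le> j" for i j
      using part_antimono[OF col, of "Suc i" "Suc j"] that unfolding \<beta>_def
      by (intro min.mono diff_le_mono) auto
    show "\<beta> i = 0" if "length L \<le> i" for i
      using that by (simp add: \<beta>_def part_def)
    show "c < ?q" by (rule c)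
    show "i = j" if "0 < \<beta> i" "\<beta> i < ?q" "0 < \<beta> j" "\<beta> j < ?q" for i j
    proof -
      have *: "Suc i \<in> {1..length L}" "(Suc a - 1) * ?q < part L (Suc i)" "part L (Suc i) < Suc a
          * ?q"
        if "0 < \<beta> i" "\<beta> i < ?q" for i
        using that by (auto simp: \<beta>_def part_def min_def split: if_splits)
      have "Suc i = Suc j"
        using T *[OF that(1,2)] *[OF that(3,4)] unfolding T_regular_def
        by (metis le_add1 plus_1_eq_Suc)
      then show ?thesis by simp
    qed
  qed
  moreover have "c < \<beta> i \<longleftrightarrow> a * ?q + c < part L (Suc i)"
    using c by (auto simp: \<beta>_def)
  ultimately show ?thesis unfolding T_conjugate_eq_sum \<beta>_def by simp
qed

lemma T_conjugate_pos_iff: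
  assumes "T_regular p L" "p \<ge> 2"
  shows "a \<ge> 1 \<and> T_conjugate p L a \<noteq> 0 \<longleftrightarrow> a \<in> {1..(part L 1 + (p - 2)) div (p - 1)}"
proof (cases a)
  case (Suc a')
  have "T_conjugate p L a \<noteq> 0 \<longleftrightarrow> a' * (p - 1) < part L 1"
    using box_iff[OF assms(1), of 0 a' 0] assms(2) by (simp add: Suc)
  also have "\<dots> \<longleftrightarrow> a * (p - 1) \<le> part L 1 + (p - 2)"
    using assms(2) by (auto simp: Suc)
  also have "\<dots> \<longleftrightarrow> a \<le> (part L 1 + (p - 2)) div (p - 1)"
    using assms(2) by (simp add: less_eq_div_iff_mult_less_eq)
  finally show ?thesis by (simp add: Suc)
qed simp

lemma T_conjugate_length_eq:
  assumes "T_regular p L" "p \<ge> 2"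
  shows "T_conjugate_length p L = (part L 1 + (p - 2)) div (p - 1)"
proof -
  have "{k. k \<ge> 1 \<and> T_conjugate p L k \<noteq> 0} = {1..(part L 1 + (p - 2)) div (p - 1)}"
    using T_conjugate_pos_iff[OF assms] by blast
  then show ?thesis unfolding T_conjugate_length_def by simp
qed

lemma T_conjugate_pos_iff_le_length:
  assumes "T_regular p L" "p \<ge> 2" "a \<ge> 1"
  shows "T_conjugate p L a > 0 \<longleftrightarrow> a \<le> T_conjugate_length p L"
  using T_conjugate_pos_iff[OF assms(1,2), of a] T_conjugate_length_eq[OF assms(1,2)] assms(3)
      by auto

text \<open>
  Column regularity says that a box of the diagram that is not in the first block stays in the
  diagram when it is moved one row down and \<open>p - 1\<close> columns to the left. This is applied to the
  last box of block \<open>a + 1\<close> in the order of \<open>box_iff\<close>.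
\<close>

lemma T_conjugate_steep:
  assumes T: "T_regular p L" and p2: "p \<ge> 2" and "a \<ge> 1" and pos: "T_conjugate p L (Suc a) > 0"
  shows "T_conjugate p L (Suc a) + (p - 1) \<le> T_conjugate p L a"
proof -
  let ?q = "p - 1"
  have q0: "?q > 0" using p2 by simp
  obtain a' where a: "a = Suc a'" using \<open>a \<ge> 1\<close> by (cases a) auto
  define x where "x = T_conjugate p L (Suc a) - 1"
  have x: "x div ?q * ?q + x mod ?q < T_conjugate p L (Suc a)" "x mod ?q < ?q"
    using pos q0 unfolding div_mult_mod_eq by (simp_all add: x_def)
  have "a * ?q + x mod ?q < part L (Suc (x div ?q))"
    using x box_iff[OF T x(2)] by simp
  also have "\<dots> \<le> part L (Suc (Suc (x div ?q))) + ?q"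
    using T by (intro part_Suc_le(2)) (simp_all add: T_regular_def)
  finally have "a' * ?q + x mod ?q < part L (Suc (Suc (x div ?q)))"
    by (simp add: a)
  then have "Suc (x div ?q) * ?q + x mod ?q < T_conjugate p L a"
    using box_iff[OF T x(2)] by (simp add: a)
  moreover have "Suc (x div ?q) * ?q + x mod ?q = ?q + x"
    by (simp only: mult_Suc add.assoc div_mult_mod_eq)
  ultimately have "x + ?q < T_conjugate p L a" by simp
  then show ?thesis using pos by (simp add: x_def)
qed

abbreviation block_sizes :: "nat \<Rightarrow> nat list \<Rightarrow> nat \<Rightarrow> nat list" where
  "block_sizes p L i \<equiv> map (T_conjugate p L) [i..<T_conjugate_length p L + 1]"

lemma steep_block_sizes:
  assumes T: "T_regular p L" and p2: "p \<ge> 2" and "i \<ge> 1"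
  shows "steep (p - 1) (block_sizes p L i)"
  using \<open>i \<ge> 1\<close>
proof (induction "T_conjugate_length p L + 1 - i" arbitrary: i)
  case (Suc d)
  let ?m = "T_conjugate_length p L"
  have IH: "steep (p - 1) (block_sizes p L (Suc i))" using Suc by simp
  have i: "block_sizes p L i = T_conjugate p L i # block_sizes p L (Suc i)"
    using Suc by (subst upt_conv_Cons) simp_all
  show ?case
  proof (cases "Suc i \<le> ?m")
    case True
    then have i': "block_sizes p L (Suc i) = T_conjugate p L (Suc i) # block_sizes p L (Suc (Suc
        i))"
      by (subst upt_conv_Cons) simp_all
    have "T_conjugate p L (Suc i) + (p - 1) \<le> T_conjugate p L i"
      using Suc.prems True T_conjugate_pos_iff_le_length[OF T p2, of "Suc i"]
      by (intro T_conjugate_steep[OF T p2]) simp_all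
    then show ?thesis using IH unfolding i i' by simp
  next
    case False
    then have "block_sizes p L (Suc i) = []" by simp
    moreover have "T_conjugate p L i > 0"
      using Suc T_conjugate_pos_iff_le_length[OF T p2, of i] by simp
    ultimately show ?thesis unfolding i by simp
  qed
qed simp

lemma steep_nth_le:
  assumes "steep q (g # gs)" "d < length gs"
  shows "gs ! d + Suc d * q \<le> g"
  using assms
proof (induction gs arbitrary: g d)
  case (Cons h hs)
  then have "h + q \<le> g" "steep q (h # hs)" by simp_all
  then show ?case
    using Cons.IH[of h "d - 1"] Cons.prems(2) by (cases d) fastforce+
qed simp

text \<open>
  The \<open>d\<close>th box above the lowest one lies in block \<open>d + 1\<close>, where its position in the order of
  \<open>box_iff\<close> is \<open>k - d q\<close>.
\<close>

lemma less_strip_height_iff: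
  assumes "steep q gs"
  shows "d < strip_height q gs k \<longleftrightarrow> d < length gs \<and> d * q \<le> k \<and> k < gs ! d + d * q"
  using assms
proof (induction gs arbitrary: d k)
  case (Cons g gs)
  have steep: "steep q gs" using Cons.prems by (rule steep_tl)
  show ?case
  proof (cases d)
    case 0
    then show ?thesis by simp
  next
    case (Suc e)
    have "k < g" if "e < length gs" "k < gs ! e + Suc e * q"
      using steep_nth_le[OF Cons.prems that(1)] that(2) by simp
    then show ?thesis
      using Cons.IH[OF steep, of e "k - q"] by (auto simp: Suc)
  qed
qed simp

text \<open>
  The lowest box of antidiagonal \<open>k + 1\<close> is in row \<open>i0 = k div q + 1\<close> and column \<open>k mod q + 1\<close>.
  The candidate in row \<open>i\<close> is in the same column of block \<open>i0 - i + 1\<close>, and \<open>box_iff\<close> together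
  with \<open>less_strip_height_iff\<close> decides which of the candidates belong to the diagram.
\<close>

lemma v_antidiagonal_eq:
  assumes T: "T_regular CARD('p::prime_card) L" and k: "k < T_conjugate CARD('p) L 1"
  shows "(v_antidiagonal L (Suc k) :: 'p fp_poly) =
    (let q = CARD('p) - 1; s = strip_height q (block_sizes CARD('p) L 1) k
     in vbracket (k div q + 2 - s) s)"
proof -
  let ?p = "CARD('p)"
  define q where "q = ?p - 1"
  define gs where "gs = block_sizes ?p L 1"
  define s where "s = strip_height q gs k"
  define i0 where "i0 = Suc (k div q)"
  have p2: "?p \<ge> 2" by (rule prime_ge_2_nat[OF prime_CARD])
  then have q0: "q > 0" by (simp add: q_def)
  have steep: "steep q gs" unfolding gs_def q_def using T p2 by (rule steep_block_sizes) simp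
  have s_iff: "d < s \<longleftrightarrow> d * q \<le> k \<and> k < T_conjugate ?p L (Suc d) + d * q" for d
  proof (cases "d < T_conjugate_length ?p L")
    case True
    then have "gs ! d = T_conjugate ?p L (Suc d)" "d < length gs"
      by (simp_all add: gs_def del: upt_Suc)
    then show ?thesis using less_strip_height_iff[OF steep, of d k] by (simp add: s_def)
  next
    case False
    then have "T_conjugate ?p L (Suc d) = 0"
      using T_conjugate_pos_iff_le_length[OF T p2, of "Suc d"] by simp
    then show ?thesis using False less_strip_height_iff[OF steep, of d k]
        by (simp add: gs_def s_def)
  qed
  have "0 < s" using s_iff[of 0] k by simp
  have "s \<le> i0" unfolding s_def i0_def by (rule strip_height_le[OF q0])
  have k_eq: "k = (i0 - 1) * q + k mod q" by (simp add: i0_def)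
  have "i \<in> fst ` antidiagonal ?p L (Suc k) \<longleftrightarrow> i \<in> {Suc i0 - s..i0}" for i
  proof -
    have "i \<in> fst ` antidiagonal ?p L (Suc k) \<longleftrightarrow>
        (1 \<le> i \<and> i \<le> i0 \<and> (i0 - i) * q + k mod q < part L i)"
    proof
      assume "i \<in> fst ` antidiagonal ?p L (Suc k)"
      then obtain j where i: "1 \<le> i" and j: "1 \<le> j" "j \<le> part L i" and eq: "j + i * q = Suc k + q"
        unfolding antidiagonal_def diagram_def q_def by auto
      have eq': "j + i * q = i0 * q + Suc (k mod q)"
        using eq k_eq by (simp add: i0_def)
      have "i \<le> i0"
      proof (rule ccontr)
        assume "\<not> i \<le> i0"
        then have "Suc i0 * q \<le> i * q" by (intro mult_le_mono1) simp
        then show False using eq' j mod_less_divisor[OF q0, of k] by simp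
      qed
      then have "i0 * q = (i0 - i) * q + i * q" by (simp flip: add_mult_distrib)
      then have "j = Suc ((i0 - i) * q + k mod q)" using eq' by simp
      then show "1 \<le> i \<and> i \<le> i0 \<and> (i0 - i) * q + k mod q < part L i"
        using i j \<open>i \<le> i0\<close> by simp
    next
      assume *: "1 \<le> i \<and> i \<le> i0 \<and> (i0 - i) * q + k mod q < part L i"
      then have "i \<le> length L" by (auto simp: part_def split: if_splits)
      have "i0 * q = (i0 - i) * q + i * q" using * by (simp flip: add_mult_distrib)
      then have "Suc ((i0 - i) * q + k mod q) + i * q = Suc k + q"
        using div_mult_mod_eq[of k q] unfolding i0_def mult_Suc by linarith
      then have "(i, Suc ((i0 - i) * q + k mod q)) \<in> antidiagonal ?p L (Suc k)"
        using * \<open>i \<le> length L\<close> unfolding antidiagonal_def diagram_def q_def by simp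
      then show "i \<in> fst ` antidiagonal ?p L (Suc k)" by (metis fst_conv image_eqI)
    qed
    also have "\<dots> \<longleftrightarrow> 1 \<le> i \<and> i \<le> i0 \<and> i0 - i < s"
    proof (cases "1 \<le> i \<and> i \<le> i0")
      case True
      then obtain i' where i': "i = Suc i'" by (cases i) auto
      define d where "d = i0 - i"
      have i0: "i0 - 1 = i' + d" using True by (simp add: d_def i')
      have kk: "k = i' * q + d * q + k mod q"
        using k_eq unfolding i0 by (simp only: add_mult_distrib)
      have "d * q + k mod q < part L i \<longleftrightarrow> i' * q + k mod q < T_conjugate ?p L (Suc d)"
        unfolding i' q_def using q0 by (intro box_iff[OF T]) (simp add: q_def)
      also have "\<dots> \<longleftrightarrow> k < T_conjugate ?p L (Suc d) + d * q"
        using kk by linarith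
      also have "\<dots> \<longleftrightarrow> d < s"
        unfolding s_iff using kk by linarith
      finally show ?thesis using True by (simp add: d_def)
    qed auto
    also have "\<dots> \<longleftrightarrow> i \<in> {Suc i0 - s..i0}"
      using \<open>s \<le> i0\<close> \<open>0 < s\<close> by auto
    finally show ?thesis .
  qed
  then have rows: "fst ` antidiagonal ?p L (Suc k) = {Suc i0 - s..i0}" by blast
  have le: "Suc i0 - s \<le> i0" using \<open>0 < s\<close> by simp
  then have "Min {Suc i0 - s..i0} = Suc i0 - s" "Max {Suc i0 - s..i0} = i0"
    by (auto intro!: Min_eqI Max_eqI)
  moreover have "i0 + 1 - (Suc i0 - s) = s" using \<open>s \<le> i0\<close> by simp
  ultimately have "v_antidiagonal L (Suc k) = (vbracket (Suc i0 - s) s :: 'p fp_poly)"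
    unfolding v_antidiagonal_def rows Let_def vbracket_def by (simp only:)
  then show ?thesis
    unfolding Let_def s_def gs_def i0_def q_def by simp
qed

lemma v_poly_eq_v_strips:
  assumes T: "T_regular CARD('p::prime_card) L"
  shows "(v_poly L :: 'p fp_poly) = v_strips (block_sizes CARD('p) L 1)"
proof -
  let ?p = "CARD('p)"
  have p2: "?p \<ge> 2" by (rule prime_ge_2_nat[OF prime_CARD])
  have "(case block_sizes ?p L 1 of [] \<Rightarrow> 0 | g # _ \<Rightarrow> g) = T_conjugate ?p L 1"
    using T_conjugate_pos_iff_le_length[OF T p2, of 1]
    by (cases "T_conjugate_length ?p L") (simp_all add: upt_conv_Cons del: upt_Suc)
  moreover have "v_poly L = (\<Prod>k<T_conjugate ?p L 1. v_antidiagonal L (Suc k) :: 'p fp_poly)"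
    unfolding v_poly_def
    by (rule prod.reindex_bij_witness[where i = Suc and j = "\<lambda>k. k - 1"]) auto
  ultimately show ?thesis
    unfolding v_strips_def Let_def using v_antidiagonal_eq[OF T]
    by (simp add: Let_def)
qed

lemma prod_blocks:
  fixes f :: "nat \<Rightarrow> 'a::comm_monoid_mult"
  shows "(\<Prod>j<n * q. f j) = (\<Prod>a<n. \<Prod>c<q. f (a * q + c))"
  by (induction n) (simp_all add: prod_lessThan_add add.commute[of q])

lemma prod_list_map_upt:
  "prod_list (map f (map \<gamma> [1..<m + 1])) = (\<Prod>a<m. f (\<gamma> (Suc a)) :: 'a::comm_monoid_mult)"
  by (induction m) simp_all

lemma w_conj_poly_eq:
  assumes T: "T_regular CARD('p::prime_card) L"
  shows "(w_conj_poly L :: 'p fp_poly) = (\<Prod>g\<leftarrow>block_sizes CARD('p) L 1. w_block g)"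
proof -
  let ?p = "CARD('p)" and ?m = "T_conjugate_length CARD('p) L"
  define q where "q = ?p - 1"
  have p2: "?p \<ge> 2" by (rule prime_ge_2_nat[OF prime_CARD])
  then have q0: "q > 0" by (simp add: q_def)
  have col: "column_regular ?p L" using T unfolding T_regular_def by blast
  have zero: "w_poly (conjugate_part L (Suc j)) = (1 :: 'p fp_poly)" if "part L 1 \<le> j" for j
  proof -
    have "part L i < Suc j" if "i \<in> {1..length L}" for i
      using part_antimono[OF col, of 1 i] \<open>part L 1 \<le> j\<close> that by simp
    then have "{i \<in> {1..length L}. Suc j \<le> part L i} = {}" by fastforce
    then show ?thesis unfolding conjugate_part_def by (simp only:) (simp add: w_poly_eq_vbracket)
  qed
  have len: "part L 1 \<le> ?m * q"
  proof (rule ccontr)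
    assume "\<not> part L 1 \<le> ?m * q"
    then have "0 < T_conjugate ?p L (Suc ?m)"
      using box_iff[OF T, of 0 ?m 0] q0 by (simp add: q_def)
    then show False using T_conjugate_pos_iff_le_length[OF T p2, of "Suc ?m"] by simp
  qed
  have block: "(\<Prod>c<q. w_poly (conjugate_part L (Suc (a * q + c)))) =
      (w_block (T_conjugate ?p L (Suc a)) :: 'p fp_poly)" if "a < ?m" for a
  proof -
    \<comment> \<open>By \<open>box_iff\<close> column \<open>c + 1\<close> of a block of size \<open>n q + b\<close> has \<open>n + 1\<close> boxes
        for \<open>c < b\<close>, and \<open>n\<close> otherwise.\<close>
    define g where "g = T_conjugate ?p L (Suc a)"
    have "g > 0" using that T_conjugate_pos_iff_le_length[OF T p2, of "Suc a"] by (simp add: g_def)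
    then obtain n b where g: "g = n * q + b" and b: "1 \<le> b" "b \<le> q"
      using block_size_cases[OF q0] by blast
    have conj: "conjugate_part L (Suc (a * q + c)) = (if c < b then Suc n else n)" if c: "c < q"
        for c
    proof -
      have "i \<in> {1..length L} \<and> Suc (a * q + c) \<le> part L i \<longleftrightarrow> i \<in> {1..if c < b then Suc n else n}"
          for i
      proof (cases i)
        case (Suc i')
        have "Suc (a * q + c) \<le> part L i \<longleftrightarrow> i' * q + c < g"
          using box_iff[OF T, of c a i'] c by (simp add: q_def Suc g_def Suc_le_eq)
        also have "\<dots> \<longleftrightarrow> i' < (if c < b then Suc n else n)"
        proof (cases i' n rule: linorder_cases)
          case less
          then have "Suc i' * q \<le> n * q" by (intro mult_le_mono1) simp
          then show ?thesis using less c unfolding g by simp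
        next
          case greater
          then have "Suc n * q \<le> i' * q" by (intro mult_le_mono1) simp
          then show ?thesis using greater b unfolding g by simp
        qed (simp add: g)
        finally have "Suc (a * q + c) \<le> part L i \<longleftrightarrow> i' < (if c < b then Suc n else n)" .
        moreover have "i \<le> length L" if "Suc (a * q + c) \<le> part L i"
          using that by (auto simp: part_def split: if_splits)
        ultimately show ?thesis unfolding Suc by (metis One_nat_def Suc_leI atLeastAtMost_iff
            le_add1 less_eq_Suc_le plus_1_eq_Suc)
      qed simp
      then have "{i \<in> {1..length L}. Suc (a * q + c) \<le> part L i} = {1..if c < b then Suc n else n}"
        by blast
      then show ?thesis unfolding conjugate_part_def by simp
    qed
    have "(\<Prod>c<q. w_poly (conjugate_part L (Suc (a * q + c)))) =
        (\<Prod>c<b + (q - b). w_poly (if c < b then Suc n else n) :: 'p fp_poly)"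
      using conj b by simp
    also have "\<dots> = w_poly n ^ (q - b) * w_poly (Suc n) ^ b"
      unfolding prod_lessThan_add by (simp add: mult.commute)
    also have "\<dots> = w_block g"
      using div_mod_pred[OF b, of n] b unfolding w_block_def Let_def q_def[symmetric] g by simp
    finally show ?thesis unfolding g_def .
  qed
  have "w_conj_poly L = (\<Prod>j<part L 1. w_poly (conjugate_part L (Suc j)) :: 'p fp_poly)"
    unfolding w_conj_poly_def
    by (rule prod.reindex_bij_witness[where i = Suc and j = "\<lambda>k. k - 1"]) auto
  also have "\<dots> = (\<Prod>j<?m * q. w_poly (conjugate_part L (Suc j)))"
    using len zero by (intro prod.mono_neutral_left) auto
  also have "\<dots> = (\<Prod>a<?m. w_block (T_conjugate ?p L (Suc a)))"
    unfolding prod_blocks using block by simp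
  also have "\<dots> = (\<Prod>g\<leftarrow>block_sizes ?p L 1. w_block g)"
    by (rule prod_list_map_upt[symmetric])
  finally show ?thesis .
qed

section \<open>The linking theorem\<close>

lemma radix_sum_map:
  "radix_sum p (map \<gamma> [i..<m + 1]) = (\<Sum>j\<in>{i..m}. p ^ (j - i) * \<gamma> j)"
proof (induction "m + 1 - i" arbitrary: i)
  case (Suc d)
  then have "i \<le> m" by simp
  then have "{i..m} = insert i {Suc i..m}" by auto
  then have "(\<Sum>j\<in>{i..m}. p ^ (j - i) * \<gamma> j) = \<gamma> i + (\<Sum>j\<in>{Suc i..m}. p ^ (j - i) * \<gamma> j)"
    by simp
  also have "(\<Sum>j\<in>{Suc i..m}. p ^ (j - i) * \<gamma> j) = p * (\<Sum>j\<in>{Suc i..m}. p ^ (j - Suc i) * \<gamma> j)"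
    unfolding sum_distrib_left
    by (rule sum.cong) (auto simp flip: power_Suc mult.assoc simp: Suc_diff_Suc)
  finally show ?case
    using Suc \<open>i \<le> m\<close> by (simp add: upt_conv_Cons del: upt_Suc)
qed simp

theorem theorem5p7:
  fixes p m :: nat and L :: "nat list"
    and \<gamma> N b :: "nat \<Rightarrow> nat" and r :: "nat \<Rightarrow> int"
  assumes "p = CARD('p::prime_card)" and "odd p"
    and "L \<noteq> []" and "last L \<noteq> 0" and "T_regular p L"
    and "\<gamma> = T_conjugate p L" and "m = T_conjugate_length p L"
    and "\<And>k. k \<in> {1..m} \<Longrightarrow>
           N k \<ge> 1 \<and> 1 \<le> b k \<and> b k \<le> p - 1 \<and> \<gamma> k = (N k - 1) * (p - 1) + b k"
    and "\<And>k. k \<in> {1..m} \<Longrightarrow>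
           r k = (int (b k) + 1) * int (p_num p (N k - 1)) - (int (N k) - 1)
                 - (\<Sum>j\<in>{k + 1..m}. int (p ^ (j - k - 1) * \<gamma> j))"
  shows "(\<forall>k\<in>{1..m}. r k \<ge> 0) \<and>
         fold (\<lambda>k. P_hat (nat (r k))) [1..<m + 1] (v_poly L :: 'p fp_poly) = w_conj_poly L"
proof -
  note N = assms(8) and r = assms(9)
  have p2: "p \<ge> 2" unfolding assms(1) by (rule prime_ge_2_nat[OF prime_CARD])
  have T: "T_regular CARD('p) L" using assms(1,5) by simp
  have blocks: "block_sizes p L i = map \<gamma> [i..<m + 1]" for i
    by (simp add: assms(6,7))
  \<comment> \<open>The numbers \<open>r k\<close> are the exponents of the recursion along the list of block sizes.\<close>
  have step: "r k \<ge> 0 \<and> nat (r k) = hat_exponent p (\<gamma> k # map \<gamma> [Suc k..<m + 1])"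
    if k: "k \<in> {1..m}" for k
  proof -
    have Nk: "N k \<ge> 1" and b: "1 \<le> b k" "b k \<le> p - 1" and \<gamma>: "\<gamma> k = (N k - 1) * (p - 1) + b k"
      using N[OF k] by blast+
    define R where "R = radix_sum p (map \<gamma> [Suc k..<m + 1])"
    have "map \<gamma> [k..<m + 1] = \<gamma> k # map \<gamma> [Suc k..<m + 1]"
      using k by (subst upt_conv_Cons) simp_all
    then have "steep (p - 1) (((N k - 1) * (p - 1) + b k) # map \<gamma> [Suc k..<m + 1])"
      using steep_block_sizes[OF assms(5) p2, of k] k unfolding blocks \<gamma> by simp
    then have le: "(N k - 1) + R \<le> (b k + 1) * p_num p (N k - 1)"
      unfolding R_def by (rule radix_sum_le[OF p2 b])
    have "int R = (\<Sum>j\<in>{k + 1..m}. int (p ^ (j - k - 1) * \<gamma> j))"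
      unfolding R_def radix_sum_map by simp
    then have "r k = int ((b k + 1) * p_num p (N k - 1)) - int (N k - 1) - int R"
      using r[OF k] Nk by (simp add: algebra_simps of_nat_diff)
    then have "r k = int ((b k + 1) * p_num p (N k - 1) - (N k - 1) - R)"
      using le by (simp only: of_nat_diff[symmetric] diff_diff_left of_nat_add[symmetric])
    moreover have "hat_exponent p (\<gamma> k # map \<gamma> [Suc k..<m + 1]) =
        (b k + 1) * p_num p (N k - 1) - (N k - 1) - R"
      unfolding hat_exponent_def list.case R_def[symmetric] \<gamma> div_mod_pred[OF b]
      using b by simp
    ultimately show ?thesis by simp
  qed
  have "fold (\<lambda>k. P_hat (nat (r k))) [i..<m + 1] f = (apply_hats (map \<gamma> [i..<m + 1]) f
      :: 'p fp_poly)"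
    if "i \<ge> 1" for i f
    using that
  proof (induction "m + 1 - i" arbitrary: i f)
    case (Suc d)
    then have "i \<in> {1..m}" and upt: "[i..<m + 1] = i # [Suc i..<m + 1]"
      by (simp_all add: upt_conv_Cons del: upt_Suc)
    then show ?case
      unfolding upt using Suc step[of i] assms(1) by (simp del: upt_Suc)
  qed simp
  then have "fold (\<lambda>k. P_hat (nat (r k))) [1..<m + 1] (v_poly L) =
      (apply_hats (map \<gamma> [1..<m + 1]) (v_poly L) :: 'p fp_poly)"
    by simp
  also have "\<dots> = w_conj_poly L"
    unfolding blocks[symmetric] assms(1) v_poly_eq_v_strips[OF T] w_conj_poly_eq[OF T]
    by (rule apply_hats_v_strips) (use steep_block_sizes[OF T] p2 assms(1) in simp)
  finally show ?thesis using step by blast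
qed

end
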